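(* Let $\check\Lambda$ be a free $\mathbb Z$-module of finite rank, $J$ an integer-valued bilinear form on $\check\Lambda$, $T=\check\Lambda\otimes U(1)$, and let $\mathcal T$ be the strict categorical torus associated to $(\check\Lambda,J)$, with the action of $\{\pm1\}$ in which $-1$ acts by the strictly monoidal functor sending $x$ to $-x$ and the arrow $x\xrightarrow{z}x+m$ to the arrow $-x\xrightarrow{z}-x-m$. The crossed module corresponding to the strict categorical group $\mathcal T^{\{\pm1\}}$ of categorical fixed points is isomorphic to the crossed module $$\Sigma\colon\check\Lambda\times U(1)\longrightarrow\widetilde{\check\Lambda},\qquad (m,z)\longmapsto(2m,1),$$ where $(n,\varepsilon)\in\widetilde{\check\Lambda}$ acts on $\check\Lambda\times U(1)$ by $(m,z)\mapsto\big(m,z\cdot(-1)^{J(m,n)}\big)$. In particular, $\mathcal T^{\{\pm1\}}$ is part of a categorical central extension $$1\longrightarrow\mathrm{pt}/\!\!/U(1)\longrightarrow\mathcal T^{\{\pm1\}}\longrightarrow\widetilde{T[2]}\longrightarrow1.$$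
   Context: Throughout $\exp\colon\mathbb R\to U(1)$, $r\mapsto e^{2\pi ir}$; $\mathfrak t=\check\Lambda\otimes\mathbb R$; $J$ is extended bilinearly to $\mathfrak t$. The categorical torus $\mathcal T=(\mathcal T,\bullet,0)$: the strict categorical group with objects $\mathfrak t$ and arrows $(x,m,z)$, written $x\xrightarrow{z}x+m$, for $x\in\mathfrak t$, $m\in\check\Lambda$, $z\in U(1)$; the composite of $x\xrightarrow{z}x+m$ followed by $x+m\xrightarrow{w}x+m+n$ is $x\xrightarrow{zw}x+m+n$; $x\bullet y=x+y$ and $(x\xrightarrow{z}x+m)\bullet(y\xrightarrow{w}y+n)=(x+y\xrightarrow{zw\exp(J(m,y))}x+y+m+n)$; unit $0$, associativity and unit isomorphisms are identities. Categorical fixed points: let a group $G$ act strictly on a category $\mathcal C$ by endofunctors ($\varrho(g)\varrho(h)=\varrho(gh)$, $\varrho(1)=\mathrm{id}$; write $g$ for $\varrho(g)$). An equivariant object is a pair $(x,\{e_g\}_{g\in G})$ with $x$ an object of $\mathcal C$ and isomorphisms $e_g\colon x\to gx$ satisfying $(ge_h)\circ e_g=e_{gh}$ for all $g,h\in G$. An equivariant arrow $(x,\mathbf e)\to(y,\mathbf f)$ is an arrow $a\colon x\to y$ with $f_g\circ a=(ga)\circ e_g$ for all $g\in G$. The category of categorical fixed points $\mathcal C^G$ is the category of equivariant objects and equivariant arrows. Since $\{\pm1\}$ acts on $\mathcal T$ by strictly monoidal functors, $\mathcal T^{\{\pm1\}}$ inherits the structure of a strict categorical group. The crossed module corresponding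 to a strict categorical group consists of the group of objects, the group of arrows that is the kernel of the source map, the homomorphism from the latter to the former given by the target map, and the action of objects on the kernel of the source by conjugation with identity arrows. $\widetilde{\check\Lambda}$ is the central extension $1\to\{\pm1\}\to\widetilde{\check\Lambda}\to\check\Lambda\to1$ with $2$-cocycle $(m,n)\mapsto(-1)^{J(m,n)}$; its elements are pairs $(m,\varepsilon)$, $m\in\check\Lambda$, $\varepsilon\in\{\pm1\}$. $T[2]\cong\check\Lambda\otimes\mathbb F_2$ is the group of points of order two (2-torsion) in $T$, and $\widetilde{T[2]}$ is the central extension $1\to\{\pm1\}\to\widetilde{T[2]}\to T[2]\to1$ defined by the $\mathbb F_2$-valued 2-cocycle $J_{\mathbb F_2}=J\otimes\mathbb F_2$ (with $\{\pm1\}$ written multiplicatively, i.e. $(v,w)\mapsto(-1)^{J_{\mathbb F_2}(v,w)}$). $\mathrm{pt}/\!\!/U(1)$ is the one-object groupoid with automorphism group $U(1)$, and the group $\widetilde{T[2]}$ is viewed as a categorical group with only identity arrows. *)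

theory Defs
  imports Complex_Main "HOL-Algebra.Free_Abelian_Groups" "HOL-Library.Z2"
begin

section \<open>Abelian groups and tensor products\<close>

text \<open>
  A \<open>\<int>\<close>-module is treated as a commutative group of HOL-Algebra, written multiplicatively; thus
  \<open>m + n\<close>, \<open>- m\<close> and \<open>2 m\<close> in a lattice \<open>L\<close> appear as \<open>m \<otimes>\<^bsub>L\<^esub> n\<close>, \<open>inv\<^bsub>L\<^esub> m\<close> and \<open>m \<otimes>\<^bsub>L\<^esub> m\<close>.
\<close>

definition free_of_finite_rank :: "('a, 'x) monoid_scheme \<Rightarrow> bool" where
  "free_of_finite_rank L \<longleftrightarrow> comm_group L \<and> (\<exists>n::nat. L \<cong> free_Abelian_group {..<n})"

definition additive_group :: "'r::ab_group_add monoid" where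
  "additive_group = \<lparr>carrier = UNIV, monoid.mult = (+), one = 0\<rparr>"

definition U1 :: "complex monoid" where
  "U1 = \<lparr>carrier = {z. cmod z = 1}, monoid.mult = (*), one = 1\<rparr>"

definition sign_group :: "complex monoid" where
  "sign_group = \<lparr>carrier = {1, -1}, monoid.mult = (*), one = 1\<rparr>"

definition circle_exp :: "real \<Rightarrow> complex" where
  "circle_exp r = exp (2 * of_real pi * \<i> * of_real r)"

definition biadditive ::
  "('a, 'x) monoid_scheme \<Rightarrow> ('b, 'y) monoid_scheme \<Rightarrow> ('c, 'z) monoid_scheme
    \<Rightarrow> ('a \<Rightarrow> 'b \<Rightarrow> 'c) \<Rightarrow> bool" where
  "biadditive A B C f \<longleftrightarrow>
     (\<forall>a \<in> carrier A. f a \<in> hom B C) \<and> (\<forall>b \<in> carrier B. (\<lambda>a. f a b) \<in> hom A C)"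

definition tensor_relations ::
  "('a, 'x) monoid_scheme \<Rightarrow> ('b, 'y) monoid_scheme \<Rightarrow> ('a \<times> 'b \<Rightarrow>\<^sub>0 int) set" where
  "tensor_relations A B =
     {frag_of (a \<otimes>\<^bsub>A\<^esub> a', b) - frag_of (a, b) - frag_of (a', b) |a a' b.
        a \<in> carrier A \<and> a' \<in> carrier A \<and> b \<in> carrier B} \<union>
     {frag_of (a, b \<otimes>\<^bsub>B\<^esub> b') - frag_of (a, b) - frag_of (a, b') |a b b'.
        a \<in> carrier A \<and> b \<in> carrier B \<and> b' \<in> carrier B}"

definition tensor_kernel ::
  "('a, 'x) monoid_scheme \<Rightarrow> ('b, 'y) monoid_scheme \<Rightarrow> ('a \<times> 'b \<Rightarrow>\<^sub>0 int) set" where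
  "tensor_kernel A B =
     generate (free_Abelian_group (carrier A \<times> carrier B)) (tensor_relations A B)"

definition tensor ::
  "('a, 'x) monoid_scheme \<Rightarrow> ('b, 'y) monoid_scheme \<Rightarrow> ('a \<times> 'b \<Rightarrow>\<^sub>0 int) set monoid" where
  "tensor A B = free_Abelian_group (carrier A \<times> carrier B) Mod tensor_kernel A B"

definition pure_tensor ::
  "('a, 'x) monoid_scheme \<Rightarrow> ('b, 'y) monoid_scheme \<Rightarrow> 'a \<Rightarrow> 'b \<Rightarrow> ('a \<times> 'b \<Rightarrow>\<^sub>0 int) set" where
  "pure_tensor A B a b =
     tensor_kernel A B #>\<^bsub>free_Abelian_group (carrier A \<times> carrier B)\<^esub> frag_of (a, b)"

text \<open>
  For biadditive \<open>f\<close> the homomorphism below exists and is unique on the carrier of the tensor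
  product; the choice operator only affects its values outside the carrier. The same remark
  applies to \<open>base_change\<close>.
\<close>

definition tensor_lift ::
  "('a, 'x) monoid_scheme \<Rightarrow> ('b, 'y) monoid_scheme \<Rightarrow> ('c, 'z) monoid_scheme
    \<Rightarrow> ('a \<Rightarrow> 'b \<Rightarrow> 'c) \<Rightarrow> ('a \<times> 'b \<Rightarrow>\<^sub>0 int) set \<Rightarrow> 'c" where
  "tensor_lift A B C f =
     (SOME h. h \<in> hom (tensor A B) C \<and>
        (\<forall>a \<in> carrier A. \<forall>b \<in> carrier B. h (pure_tensor A B a b) = f a b))"

text \<open>The form \<open>J \<otimes> R\<close> on \<open>L \<otimes> R\<close>, for \<open>R\<close> the commutative ring \<open>'r\<close>.\<close>

definition base_change ::
  "('l, 'x) monoid_scheme \<Rightarrow> ('l \<Rightarrow> 'l \<Rightarrow> int)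
    \<Rightarrow> ('l \<times> 'r::comm_ring_1 \<Rightarrow>\<^sub>0 int) set \<Rightarrow> ('l \<times> 'r \<Rightarrow>\<^sub>0 int) set \<Rightarrow> 'r" where
  "base_change L J =
     (SOME \<beta>. biadditive (tensor L additive_group) (tensor L additive_group) additive_group \<beta> \<and>
        (\<forall>m \<in> carrier L. \<forall>n \<in> carrier L. \<forall>r s.
           \<beta> (pure_tensor L additive_group m r) (pure_tensor L additive_group n s)
             = of_int (J m n) * (r * s)))"


section \<open>Strict categorical groups\<close>

text \<open>
  \<open>Comp C f g\<close> is the composite \<open>f \<circ> g\<close>, i.e. first \<open>g\<close>, then \<open>f\<close>.
\<close>

record ('o, 'a) category =
  Obj :: "'o set"
  Arr :: "'a set"
  Src :: "'a \<Rightarrow> 'o"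
  Tgt :: "'a \<Rightarrow> 'o"
  Ident :: "'o \<Rightarrow> 'a"
  Comp :: "'a \<Rightarrow> 'a \<Rightarrow> 'a"

record ('o, 'a) strict_monoidal_category = "('o, 'a) category" +
  Tobj :: "'o \<Rightarrow> 'o \<Rightarrow> 'o"
  Tarr :: "'a \<Rightarrow> 'a \<Rightarrow> 'a"
  Tunit :: 'o

definition is_category :: "('o, 'a, 'x) category_scheme \<Rightarrow> bool" where
  "is_category C \<longleftrightarrow>
     (\<forall>f \<in> Arr C. Src C f \<in> Obj C \<and> Tgt C f \<in> Obj C) \<and>
     (\<forall>x \<in> Obj C. Ident C x \<in> Arr C \<and> Src C (Ident C x) = x \<and> Tgt C (Ident C x) = x) \<and>
     (\<forall>f \<in> Arr C. \<forall>g \<in> Arr C. Tgt C g = Src C f \<longrightarrow>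
        Comp C f g \<in> Arr C \<and> Src C (Comp C f g) = Src C g \<and> Tgt C (Comp C f g) = Tgt C f) \<and>
     (\<forall>f \<in> Arr C. Comp C f (Ident C (Src C f)) = f \<and> Comp C (Ident C (Tgt C f)) f = f) \<and>
     (\<forall>f \<in> Arr C. \<forall>g \<in> Arr C. \<forall>h \<in> Arr C. Tgt C h = Src C g \<and> Tgt C g = Src C f \<longrightarrow>
        Comp C f (Comp C g h) = Comp C (Comp C f g) h)"

definition is_isoarrow :: "('o, 'a, 'x) category_scheme \<Rightarrow> 'a \<Rightarrow> bool" where
  "is_isoarrow C f \<longleftrightarrow> f \<in> Arr C \<and>
     (\<exists>g \<in> Arr C. Src C g = Tgt C f \<and> Tgt C g = Src C f \<and>
        Comp C g f = Ident C (Src C f) \<and> Comp C f g = Ident C (Tgt C f))"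

definition object_group :: "('o, 'a, 'x) strict_monoidal_category_scheme \<Rightarrow> 'o monoid" where
  "object_group C = \<lparr>carrier = Obj C, monoid.mult = Tobj C, one = Tunit C\<rparr>"

definition arrow_group :: "('o, 'a, 'x) strict_monoidal_category_scheme \<Rightarrow> 'a monoid" where
  "arrow_group C = \<lparr>carrier = Arr C, monoid.mult = Tarr C, one = Ident C (Tunit C)\<rparr>"

text \<open>A strict categorical group is a group object in the category of small categories.\<close>

definition strict_categorical_group :: "('o, 'a, 'x) strict_monoidal_category_scheme \<Rightarrow> bool" where
  "strict_categorical_group C \<longleftrightarrow>
     is_category C \<and> group (object_group C) \<and> group (arrow_group C) \<and>
     Src C \<in> hom (arrow_group C) (object_group C) \<and>
     Tgt C \<in> hom (arrow_group C) (object_group C) \<and>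
     Ident C \<in> hom (object_group C) (arrow_group C) \<and>
     (\<forall>f \<in> Arr C. \<forall>g \<in> Arr C. \<forall>f' \<in> Arr C. \<forall>g' \<in> Arr C.
        Tgt C g = Src C f \<and> Tgt C g' = Src C f' \<longrightarrow>
        Tarr C (Comp C f g) (Comp C f' g') = Comp C (Tarr C f f') (Tarr C g g'))"

record ('o, 'a, 'p, 'b) cat_map =
  Fobj :: "'o \<Rightarrow> 'p"
  Farr :: "'a \<Rightarrow> 'b"

definition is_functor ::
  "('o, 'a, 'x) category_scheme \<Rightarrow> ('p, 'b, 'y) category_scheme \<Rightarrow> ('o, 'a, 'p, 'b) cat_map \<Rightarrow> bool"
  where
  "is_functor C D F \<longleftrightarrow>
     (\<forall>x \<in> Obj C. Fobj F x \<in> Obj D \<and> Farr F (Ident C x) = Ident D (Fobj F x)) \<and>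
     (\<forall>f \<in> Arr C. Farr F f \<in> Arr D \<and>
        Src D (Farr F f) = Fobj F (Src C f) \<and> Tgt D (Farr F f) = Fobj F (Tgt C f)) \<and>
     (\<forall>f \<in> Arr C. \<forall>g \<in> Arr C. Tgt C g = Src C f \<longrightarrow>
        Farr F (Comp C f g) = Comp D (Farr F f) (Farr F g))"

definition strict_monoidal_functor ::
  "('o, 'a, 'x) strict_monoidal_category_scheme \<Rightarrow> ('p, 'b, 'y) strict_monoidal_category_scheme
    \<Rightarrow> ('o, 'a, 'p, 'b) cat_map \<Rightarrow> bool" where
  "strict_monoidal_functor C D F \<longleftrightarrow>
     is_functor C D F \<and> Fobj F (Tunit C) = Tunit D \<and>
     (\<forall>x \<in> Obj C. \<forall>y \<in> Obj C. Fobj F (Tobj C x y) = Tobj D (Fobj F x) (Fobj F y)) \<and>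
     (\<forall>f \<in> Arr C. \<forall>g \<in> Arr C. Farr F (Tarr C f g) = Tarr D (Farr F f) (Farr F g))"


section \<open>Categorical fixed points\<close>

definition strict_monoidal_action ::
  "('g, 'y) monoid_scheme \<Rightarrow> ('o, 'a, 'x) strict_monoidal_category_scheme
    \<Rightarrow> ('g \<Rightarrow> ('o, 'a, 'o, 'a) cat_map) \<Rightarrow> bool" where
  "strict_monoidal_action G C \<rho> \<longleftrightarrow>
     group G \<and>
     (\<forall>g \<in> carrier G. strict_monoidal_functor C C (\<rho> g)) \<and>
     (\<forall>x \<in> Obj C. Fobj (\<rho> \<one>\<^bsub>G\<^esub>) x = x) \<and>
     (\<forall>f \<in> Arr C. Farr (\<rho> \<one>\<^bsub>G\<^esub>) f = f) \<and>
     (\<forall>g \<in> carrier G. \<forall>h \<in> carrier G. \<forall>x \<in> Obj C.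
        Fobj (\<rho> g) (Fobj (\<rho> h) x) = Fobj (\<rho> (g \<otimes>\<^bsub>G\<^esub> h)) x) \<and>
     (\<forall>g \<in> carrier G. \<forall>h \<in> carrier G. \<forall>f \<in> Arr C.
        Farr (\<rho> g) (Farr (\<rho> h) f) = Farr (\<rho> (g \<otimes>\<^bsub>G\<^esub> h)) f)"

text \<open>
  The families \<open>e\<close> are required to be extensional, so that two families are equal as soon as they
  agree on \<open>G\<close>.
\<close>

definition equivariant_objects ::
  "('g, 'y) monoid_scheme \<Rightarrow> ('o, 'a, 'x) category_scheme
    \<Rightarrow> ('g \<Rightarrow> ('o, 'a, 'o, 'a) cat_map) \<Rightarrow> ('o \<times> ('g \<Rightarrow> 'a)) set" where
  "equivariant_objects G C \<rho> =
     {(x, e). x \<in> Obj C \<and> e \<in> extensional (carrier G) \<and>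
        (\<forall>g \<in> carrier G. is_isoarrow C (e g) \<and> Src C (e g) = x \<and> Tgt C (e g) = Fobj (\<rho> g) x) \<and>
        (\<forall>g \<in> carrier G. \<forall>h \<in> carrier G.
           Comp C (Farr (\<rho> g) (e h)) (e g) = e (g \<otimes>\<^bsub>G\<^esub> h))}"

text \<open>Equivariant arrows carry their equivariant source and target.\<close>

definition equivariant_arrows ::
  "('g, 'y) monoid_scheme \<Rightarrow> ('o, 'a, 'x) category_scheme
    \<Rightarrow> ('g \<Rightarrow> ('o, 'a, 'o, 'a) cat_map)
    \<Rightarrow> (('o \<times> ('g \<Rightarrow> 'a)) \<times> 'a \<times> ('o \<times> ('g \<Rightarrow> 'a))) set" where
  "equivariant_arrows G C \<rho> =
     {((x, e), a, (y, f)).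
        (x, e) \<in> equivariant_objects G C \<rho> \<and> (y, f) \<in> equivariant_objects G C \<rho> \<and>
        a \<in> Arr C \<and> Src C a = x \<and> Tgt C a = y \<and>
        (\<forall>g \<in> carrier G. Comp C (f g) a = Comp C (Farr (\<rho> g) a) (e g))}"

definition fixed_points ::
  "('g, 'y) monoid_scheme \<Rightarrow> ('o, 'a, 'x) strict_monoidal_category_scheme
    \<Rightarrow> ('g \<Rightarrow> ('o, 'a, 'o, 'a) cat_map)
    \<Rightarrow> ('o \<times> ('g \<Rightarrow> 'a), ('o \<times> ('g \<Rightarrow> 'a)) \<times> 'a \<times> ('o \<times> ('g \<Rightarrow> 'a)))
         strict_monoidal_category" where
  "fixed_points G C \<rho> =
     (let tobj = (\<lambda>(x, e) (y, f). (Tobj C x y, \<lambda>g \<in> carrier G. Tarr C (e g) (f g))) in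
     \<lparr>Obj = equivariant_objects G C \<rho>,
      Arr = equivariant_arrows G C \<rho>,
      Src = (\<lambda>(s, a, t). s),
      Tgt = (\<lambda>(s, a, t). t),
      Ident = (\<lambda>(x, e). ((x, e), Ident C x, (x, e))),
      Comp = (\<lambda>(s', a', t') (s, a, t). (s, Comp C a' a, t')),
      Tobj = tobj,
      Tarr = (\<lambda>(s, a, t) (s', a', t'). (tobj s s', Tarr C a a', tobj t t')),
      Tunit = (Tunit C, \<lambda>g \<in> carrier G. Ident C (Tunit C))\<rparr>)"


section \<open>Crossed modules\<close>

record ('b, 't) xmod =
  Base :: "'b monoid"
  Top :: "'t monoid"
  Boundary :: "'t \<Rightarrow> 'b"
  Act :: "'b \<Rightarrow> 't \<Rightarrow> 't"

definition crossed_module :: "('b, 't) xmod \<Rightarrow> bool" where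
  "crossed_module M \<longleftrightarrow>
     group (Base M) \<and> group (Top M) \<and> Boundary M \<in> hom (Top M) (Base M) \<and>
     (\<forall>b \<in> carrier (Base M). Act M b \<in> iso (Top M) (Top M)) \<and>
     (\<forall>t \<in> carrier (Top M). Act M \<one>\<^bsub>Base M\<^esub> t = t) \<and>
     (\<forall>b \<in> carrier (Base M). \<forall>c \<in> carrier (Base M). \<forall>t \<in> carrier (Top M).
        Act M (b \<otimes>\<^bsub>Base M\<^esub> c) t = Act M b (Act M c t)) \<and>
     (\<forall>b \<in> carrier (Base M). \<forall>t \<in> carrier (Top M).
        Boundary M (Act M b t) = b \<otimes>\<^bsub>Base M\<^esub> Boundary M t \<otimes>\<^bsub>Base M\<^esub> inv\<^bsub>Base M\<^esub> b) \<and>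
     (\<forall>s \<in> carrier (Top M). \<forall>t \<in> carrier (Top M).
        Act M (Boundary M s) t = s \<otimes>\<^bsub>Top M\<^esub> t \<otimes>\<^bsub>Top M\<^esub> inv\<^bsub>Top M\<^esub> s)"

definition crossed_module_isomorphic :: "('b, 't) xmod \<Rightarrow> ('c, 'u) xmod \<Rightarrow> bool" where
  "crossed_module_isomorphic M N \<longleftrightarrow>
     crossed_module M \<and> crossed_module N \<and>
     (\<exists>\<phi> \<psi>. \<phi> \<in> iso (Top M) (Top N) \<and> \<psi> \<in> iso (Base M) (Base N) \<and>
        (\<forall>t \<in> carrier (Top M). Boundary N (\<phi> t) = \<psi> (Boundary M t)) \<and>
        (\<forall>b \<in> carrier (Base M). \<forall>t \<in> carrier (Top M). \<phi> (Act M b t) = Act N (\<psi> b) (\<phi> t)))"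

definition crossed_module_of :: "('o, 'a, 'x) strict_monoidal_category_scheme \<Rightarrow> ('o, 'a) xmod" where
  "crossed_module_of C =
     \<lparr>Base = object_group C,
      Top = (arrow_group C)\<lparr>carrier := kernel (arrow_group C) (object_group C) (Src C)\<rparr>,
      Boundary = Tgt C,
      Act = (\<lambda>x a. Ident C x \<otimes>\<^bsub>arrow_group C\<^esub> a \<otimes>\<^bsub>arrow_group C\<^esub> inv\<^bsub>arrow_group C\<^esub> (Ident C x))\<rparr>"


section \<open>Central extensions\<close>

text \<open>
  The central extension of \<open>A\<close> by \<open>{1, -1}\<close> defined by a normalised sign-valued 2-cocycle \<open>c\<close>.
\<close>

definition sign_extension :: "('a, 'x) monoid_scheme \<Rightarrow> ('a \<Rightarrow> 'a \<Rightarrow> complex) \<Rightarrow> ('a \<times> complex) monoid"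
  where
  "sign_extension A c =
     \<lparr>carrier = carrier A \<times> carrier sign_group,
      monoid.mult = (\<lambda>(a, \<epsilon>) (b, \<delta>). (a \<otimes>\<^bsub>A\<^esub> b, \<epsilon> * \<delta> * c a b)),
      one = (\<one>\<^bsub>A\<^esub>, 1)\<rparr>"

text \<open>The categorical group \<open>pt//A\<close> for an abelian group \<open>A\<close>.\<close>

definition delooping :: "('a, 'x) monoid_scheme \<Rightarrow> (unit, 'a) strict_monoidal_category" where
  "delooping A =
     \<lparr>Obj = {()}, Arr = carrier A, Src = (\<lambda>_. ()), Tgt = (\<lambda>_. ()), Ident = (\<lambda>_. \<one>\<^bsub>A\<^esub>),
      Comp = monoid.mult A, Tobj = (\<lambda>_ _. ()), Tarr = monoid.mult A, Tunit = ()\<rparr>"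

text \<open>A group viewed as a categorical group with only identity arrows.\<close>

definition discrete :: "('a, 'x) monoid_scheme \<Rightarrow> ('a, 'a) strict_monoidal_category" where
  "discrete Q =
     \<lparr>Obj = carrier Q, Arr = carrier Q, Src = (\<lambda>q. q), Tgt = (\<lambda>q. q), Ident = (\<lambda>q. q),
      Comp = (\<lambda>q _. q), Tobj = monoid.mult Q, Tarr = monoid.mult Q, Tunit = \<one>\<^bsub>Q\<^esub>\<rparr>"

text \<open>
  Exactness of \<open>1 \<rightarrow> pt//A \<rightarrow> C \<rightarrow> Q \<rightarrow> 1\<close>, with \<open>Q\<close> discrete, means that \<open>p\<close> is surjective on objects
  and that \<open>i\<close> is an equivalence of categories onto the kernel of \<open>p\<close>, i.e. onto the full
  subcategory of the objects mapped to \<open>1\<close>. As \<open>i\<close> sends the only object to the unit object, the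
  latter says that \<open>i\<close> is a bijection from \<open>A\<close> to the endomorphisms of the unit object, and that
  every object of the kernel is isomorphic to the unit object. Centrality says that conjugation
  by objects fixes the image of \<open>pt//A\<close>.
\<close>

definition categorical_central_extension ::
  "('c, 'y) monoid_scheme \<Rightarrow> ('o, 'a, 'x) strict_monoidal_category_scheme \<Rightarrow> ('q, 'z) monoid_scheme
    \<Rightarrow> (unit, 'c, 'o, 'a) cat_map \<Rightarrow> ('o, 'a, 'q, 'q) cat_map \<Rightarrow> bool" where
  "categorical_central_extension A C Q i p \<longleftrightarrow>
     comm_group A \<and> strict_categorical_group C \<and> group Q \<and>
     strict_monoidal_functor (delooping A) C i \<and>
     strict_monoidal_functor C (discrete Q) p \<and>
     Fobj p ` Obj C = carrier Q \<and>
     bij_betw (Farr i) (carrier A) {f \<in> Arr C. Src C f = Tunit C \<and> Tgt C f = Tunit C} \<and>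
     (\<forall>x \<in> Obj C. Fobj p x = \<one>\<^bsub>Q\<^esub> \<longrightarrow>
        (\<exists>f. is_isoarrow C f \<and> Src C f = Tunit C \<and> Tgt C f = x)) \<and>
     (\<forall>a \<in> carrier A. \<forall>x \<in> Obj C.
        Tarr C (Ident C x) (Farr i a) = Tarr C (Farr i a) (Ident C x))"


section \<open>The categorical torus and its inversion\<close>

abbreviation lie ::
  "('l, 'x) monoid_scheme \<Rightarrow> ('l \<times> real \<Rightarrow>\<^sub>0 int) set monoid" where
  "lie L \<equiv> tensor L (additive_group :: real monoid)"

definition lattice_incl :: "('l, 'x) monoid_scheme \<Rightarrow> 'l \<Rightarrow> ('l \<times> real \<Rightarrow>\<^sub>0 int) set" where
  "lattice_incl L m = pure_tensor L additive_group m 1"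

text \<open>The triple \<open>(x, m, z)\<close> is the arrow from \<open>x\<close> to \<open>x + m\<close> labelled by \<open>z\<close>.\<close>

definition categorical_torus ::
  "('l, 'x) monoid_scheme \<Rightarrow> ('l \<Rightarrow> 'l \<Rightarrow> int)
    \<Rightarrow> (('l \<times> real \<Rightarrow>\<^sub>0 int) set, ('l \<times> real \<Rightarrow>\<^sub>0 int) set \<times> 'l \<times> complex)
         strict_monoidal_category" where
  "categorical_torus L J =
     \<lparr>Obj = carrier (lie L),
      Arr = carrier (lie L) \<times> carrier L \<times> carrier U1,
      Src = (\<lambda>(x, m, z). x),
      Tgt = (\<lambda>(x, m, z). x \<otimes>\<^bsub>lie L\<^esub> lattice_incl L m),
      Ident = (\<lambda>x. (x, \<one>\<^bsub>L\<^esub>, 1)),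
      Comp = (\<lambda>(y, n, w) (x, m, z). (x, m \<otimes>\<^bsub>L\<^esub> n, z * w)),
      Tobj = monoid.mult (lie L),
      Tarr = (\<lambda>(x, m, z) (y, n, w).
        (x \<otimes>\<^bsub>lie L\<^esub> y, m \<otimes>\<^bsub>L\<^esub> n, z * w * circle_exp (base_change L J (lattice_incl L m) y))),
      Tunit = \<one>\<^bsub>lie L\<^esub>\<rparr>"

definition torus_inversion ::
  "('l, 'x) monoid_scheme \<Rightarrow> complex
    \<Rightarrow> (('l \<times> real \<Rightarrow>\<^sub>0 int) set, ('l \<times> real \<Rightarrow>\<^sub>0 int) set \<times> 'l \<times> complex,
        ('l \<times> real \<Rightarrow>\<^sub>0 int) set, ('l \<times> real \<Rightarrow>\<^sub>0 int) set \<times> 'l \<times> complex) cat_map" where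
  "torus_inversion L \<epsilon> =
     (if \<epsilon> = 1 then \<lparr>Fobj = (\<lambda>x. x), Farr = (\<lambda>f. f)\<rparr>
      else \<lparr>Fobj = (\<lambda>x. inv\<^bsub>lie L\<^esub> x), Farr = (\<lambda>(x, m, z). (inv\<^bsub>lie L\<^esub> x, inv\<^bsub>L\<^esub> m, z))\<rparr>)"

definition torus_fixed_points where
  "torus_fixed_points L J = fixed_points sign_group (categorical_torus L J) (torus_inversion L)"


section \<open>The crossed module and the two sign extensions\<close>

definition lattice_ext :: "('l, 'x) monoid_scheme \<Rightarrow> ('l \<Rightarrow> 'l \<Rightarrow> int) \<Rightarrow> ('l \<times> complex) monoid" where
  "lattice_ext L J = sign_extension L (\<lambda>m n. (-1) powi J m n)"

definition Sigma_xmod ::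
  "('l, 'x) monoid_scheme \<Rightarrow> ('l \<Rightarrow> 'l \<Rightarrow> int) \<Rightarrow> ('l \<times> complex, 'l \<times> complex) xmod" where
  "Sigma_xmod L J =
     \<lparr>Base = lattice_ext L J,
      Top = L \<times>\<times> U1,
      Boundary = (\<lambda>(m, z). (m \<otimes>\<^bsub>L\<^esub> m, 1)),
      Act = (\<lambda>(n, \<epsilon>) (m, z). (m, z * (-1) powi J m n))\<rparr>"

definition two_torsion :: "('a, 'x) monoid_scheme \<Rightarrow> ('a, 'x) monoid_scheme" where
  "two_torsion A = A\<lparr>carrier := {a \<in> carrier A. a \<otimes>\<^bsub>A\<^esub> a = \<one>\<^bsub>A\<^esub>}\<rparr>"

definition bit_sign :: "bit \<Rightarrow> complex" where
  "bit_sign b = (if b = 0 then 1 else -1)"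

text \<open>
  The canonical isomorphism from \<open>L \<otimes> F_2\<close> to the 2-torsion of \<open>L \<otimes> U(1)\<close>, induced by the inclusion
  of \<open>F_2 = {1, -1}\<close> into \<open>U(1)\<close>.
\<close>

definition mod2_to_torus ::
  "('l, 'x) monoid_scheme \<Rightarrow> ('l \<times> bit \<Rightarrow>\<^sub>0 int) set \<Rightarrow> ('l \<times> complex \<Rightarrow>\<^sub>0 int) set" where
  "mod2_to_torus L =
     tensor_lift L additive_group (tensor L U1) (\<lambda>m b. pure_tensor L U1 m (bit_sign b))"

definition torus_to_mod2 ::
  "('l, 'x) monoid_scheme \<Rightarrow> ('l \<times> complex \<Rightarrow>\<^sub>0 int) set \<Rightarrow> ('l \<times> bit \<Rightarrow>\<^sub>0 int) set" where
  "torus_to_mod2 L = inv_into (carrier (tensor L additive_group)) (mod2_to_torus L)"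

definition two_torsion_ext ::
  "('l, 'x) monoid_scheme \<Rightarrow> ('l \<Rightarrow> 'l \<Rightarrow> int) \<Rightarrow> (('l \<times> complex \<Rightarrow>\<^sub>0 int) set \<times> complex) monoid" where
  "two_torsion_ext L J =
     sign_extension (two_torsion (tensor L U1))
       (\<lambda>v w. bit_sign (base_change L J (torus_to_mod2 L v) (torus_to_mod2 L w)))"

end

theory Submission
  imports Defs
begin

text \<open>
  An equivariant object of the torus consists of \<open>x\<close> and an arrow \<open>e_{-1}\<close> from \<open>x\<close> to \<open>-x\<close>. As
  \<open>L \<otimes> \<real>\<close> is uniquely 2-divisible, the lattice component \<open>-n\<close> of \<open>e_{-1}\<close> determines \<open>x = n/2\<close>, and
  the cocycle condition says that the label of \<open>e_{-1}\<close> is a sign \<open>\<epsilon>\<close>. Tensoring \<open>(n, \<epsilon>)\<close> with \<open>(k, \<delta>)\<close>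
  produces the extra factor \<open>exp (J(-n, k/2)) = (-1)^J(n, k)\<close>, so the objects form the extension of \<open>L\<close>
  by signs. An equivariant arrow from \<open>(n, \<epsilon>)\<close> is a pair \<open>(m, z)\<close> and ends at \<open>(n + 2m, \<epsilon>)\<close>; conjugating
  an arrow out of the unit by \<open>n/2\<close> multiplies its label by \<open>exp (J(m, -n/2)) = (-1)^J(m, n)\<close>. Hence
  isomorphism classes of objects are pairs of a class in \<open>L/2L\<close> and a sign, and \<open>n \<mapsto> n \<otimes> (-1)\<close>
  identifies \<open>L/2L\<close> with the 2-torsion of \<open>L \<otimes> U(1)\<close>.
\<close>

section \<open>Tensor products of abelian groups\<close>

text \<open>The groups \<open>lie L\<close>, \<open>tensor L U1\<close> and L \<otimes> F_2 are bare
  quotients of free Abelian groups, and \<open>base_change\<close> and \<open>tensor_lift\<close>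
  are choices. Every map out of a tensor product, even division by 2, therefore has to be produced
  by the universal property and then evaluated on pure tensors. All signs come from one identity,
  \<open>circle_exp (of_int j / 2) = (-1) powi j\<close>. Integrality of \<open>J\<close> itself
  gives the interchange law of the torus: the factor exp (J(m, y)) depends on y only modulo the
  lattice. That n \<mapsto> n \<otimes> (-1) has kernel exactly 2L cannot be read off from the
  quotient. A basis of \<open>L\<close> supplies characters \<open>\<chi> i\<close> of
  \<open>tensor L U1\<close> that detect parity and from which every tensor can be rebuilt. Freeness
  enters once more as absence of 2-torsion, which makes the endomorphisms of the unit exactly U(1).
  The sign cocycle on the points of order two is defined through an \<open>inv_into\<close> back to
  L \<otimes> F_2; it becomes computable once the canonical map is known to be injective.\<close>

lemma comm_group_additive_group [simp, intro]: "comm_group (additive_group :: 'r::ab_group_add monoid)"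
proof (rule comm_groupI)
  fix x :: 'r
  show "\<exists>y\<in>carrier additive_group. y \<otimes>\<^bsub>additive_group\<^esub> x = \<one>\<^bsub>additive_group\<^esub>"
    by (rule bexI[of _ "- x"]) (auto simp: additive_group_def)
qed (auto simp: additive_group_def algebra_simps)

lemma additive_group_simps [simp]:
  "carrier additive_group = UNIV" "x \<otimes>\<^bsub>additive_group\<^esub> y = x + y" "\<one>\<^bsub>additive_group\<^esub> = 0"
  by (auto simp: additive_group_def)

lemma inv_additive_group [simp]: "inv\<^bsub>additive_group\<^esub> x = - (x :: 'r::ab_group_add)"
  using comm_group.axioms(2)[OF comm_group_additive_group]
  by (intro group.inv_equality) auto

lemma comm_group_U1 [simp, intro]: "comm_group U1"
proof (rule comm_groupI)
  fix z assume "z \<in> carrier U1"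
  then show "\<exists>w\<in>carrier U1. w \<otimes>\<^bsub>U1\<^esub> z = \<one>\<^bsub>U1\<^esub>"
    by (intro bexI[of _ "inverse z"]) (auto simp: U1_def norm_inverse intro: left_inverse)
qed (auto simp: U1_def norm_mult)

lemma U1_simps [simp]:
  "z \<in> carrier U1 \<longleftrightarrow> cmod z = 1" "z \<otimes>\<^bsub>U1\<^esub> w = z * w" "\<one>\<^bsub>U1\<^esub> = 1"
  by (auto simp: U1_def)

lemma inv_U1 [simp]: "cmod z = 1 \<Longrightarrow> inv\<^bsub>U1\<^esub> z = inverse z"
  using comm_group.axioms(2)[OF comm_group_U1]
  by (intro group.inv_equality) (auto simp: norm_inverse intro: left_inverse)

lemma comm_group_sign_group [simp, intro]: "comm_group sign_group"
  by (rule comm_groupI) (auto simp: sign_group_def)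

lemma sign_group_simps [simp]:
  "carrier sign_group = {1, -1}" "z \<otimes>\<^bsub>sign_group\<^esub> w = z * w" "\<one>\<^bsub>sign_group\<^esub> = 1"
  by (auto simp: sign_group_def)

lemma group_hom_if_hom: "group G \<Longrightarrow> group H \<Longrightarrow> h \<in> hom G H \<Longrightarrow> group_hom G H h"
  by (simp add: group_hom_def group_hom_axioms_def)

lemma biadditiveI:
  assumes "\<And>a b. a \<in> carrier A \<Longrightarrow> b \<in> carrier B \<Longrightarrow> f a b \<in> carrier C"
    and "\<And>a a' b. a \<in> carrier A \<Longrightarrow> a' \<in> carrier A \<Longrightarrow> b \<in> carrier B \<Longrightarrow>
      f (a \<otimes>\<^bsub>A\<^esub> a') b = f a b \<otimes>\<^bsub>C\<^esub> f a' b"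
    and "\<And>a b b'. a \<in> carrier A \<Longrightarrow> b \<in> carrier B \<Longrightarrow> b' \<in> carrier B \<Longrightarrow>
      f a (b \<otimes>\<^bsub>B\<^esub> b') = f a b \<otimes>\<^bsub>C\<^esub> f a b'"
  shows "biadditive A B C f"
  using assms by (auto simp: biadditive_def hom_def)

lemma biadditiveD:
  assumes "biadditive A B C f"
  shows "a \<in> carrier A \<Longrightarrow> b \<in> carrier B \<Longrightarrow> f a b \<in> carrier C"
    and "a \<in> carrier A \<Longrightarrow> a' \<in> carrier A \<Longrightarrow> b \<in> carrier B \<Longrightarrow>
      f (a \<otimes>\<^bsub>A\<^esub> a') b = f a b \<otimes>\<^bsub>C\<^esub> f a' b"
    and "a \<in> carrier A \<Longrightarrow> b \<in> carrier B \<Longrightarrow> b' \<in> carrier B \<Longrightarrow>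
      f a (b \<otimes>\<^bsub>B\<^esub> b') = f a b \<otimes>\<^bsub>C\<^esub> f a b'"
  using assms by (auto simp: biadditive_def hom_def Pi_iff)

lemma biadditive_group:
  assumes "group A" "group B" "group C" "biadditive A B C f"
  shows "b \<in> carrier B \<Longrightarrow> f \<one>\<^bsub>A\<^esub> b = \<one>\<^bsub>C\<^esub>"
    and "a \<in> carrier A \<Longrightarrow> f a \<one>\<^bsub>B\<^esub> = \<one>\<^bsub>C\<^esub>"
    and "a \<in> carrier A \<Longrightarrow> b \<in> carrier B \<Longrightarrow> f (inv\<^bsub>A\<^esub> a) b = inv\<^bsub>C\<^esub> f a b"
    and "a \<in> carrier A \<Longrightarrow> b \<in> carrier B \<Longrightarrow> f a (inv\<^bsub>B\<^esub> b) = inv\<^bsub>C\<^esub> f a b"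
proof -
  show "f \<one>\<^bsub>A\<^esub> b = \<one>\<^bsub>C\<^esub>" if "b \<in> carrier B"
    using group_hom.hom_one[OF group_hom_if_hom[of A C "\<lambda>a. f a b"]] assms that
    by (auto simp: biadditive_def)
  show "f a \<one>\<^bsub>B\<^esub> = \<one>\<^bsub>C\<^esub>" if "a \<in> carrier A"
    using group_hom.hom_one[OF group_hom_if_hom[of B C "f a"]] assms that
    by (auto simp: biadditive_def)
  show "f (inv\<^bsub>A\<^esub> a) b = inv\<^bsub>C\<^esub> f a b" if "a \<in> carrier A" "b \<in> carrier B"
    using group_hom.hom_inv[OF group_hom_if_hom[of A C "\<lambda>a. f a b"]] assms that
    by (auto simp: biadditive_def)
  show "f a (inv\<^bsub>B\<^esub> b) = inv\<^bsub>C\<^esub> f a b" if "a \<in> carrier A" "b \<in> carrier B"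
    using group_hom.hom_inv[OF group_hom_if_hom[of B C "f a"]] assms that
    by (auto simp: biadditive_def)
qed

section \<open>The tensor product as a quotient, and its universal property\<close>

locale comm_group_pair = A: comm_group A + B: comm_group B
  for A :: "('a, 'x) monoid_scheme" and B :: "('b, 'y) monoid_scheme"
begin

abbreviation "F \<equiv> free_Abelian_group (carrier A \<times> carrier B)"
abbreviation "K \<equiv> tensor_kernel A B"

lemma relations_closed: "tensor_relations A B \<subseteq> carrier F"
  unfolding tensor_relations_def
  by (auto intro!: group.inv_closed
      dest!: subsetD[OF keys_diff] simp: keys_frag_of split: if_splits)

lemma normal_kernel: "K \<lhd> F"
proof -
  interpret F: comm_group F by (rule abelian_free_Abelian_group)
  have "subgroup K F"
    unfolding tensor_kernel_def by (rule F.generate_is_subgroup[OF relations_closed])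
  then show ?thesis by (rule F.subgroup_imp_normal)
qed

lemma comm_group_tensor: "comm_group (tensor A B)"
  unfolding tensor_def
  using comm_group.abelian_FactGroup[OF abelian_free_Abelian_group normal_imp_subgroup[OF normal_kernel]] .

lemma projection_hom: "(\<lambda>c. K #>\<^bsub>F\<^esub> c) \<in> hom F (tensor A B)"
  unfolding tensor_def by (rule normal.r_coset_hom_Mod[OF normal_kernel])

lemma pure_tensor_closed [simp]:
  "a \<in> carrier A \<Longrightarrow> b \<in> carrier B \<Longrightarrow> pure_tensor A B a b \<in> carrier (tensor A B)"
  unfolding pure_tensor_def by (rule hom_in_carrier[OF projection_hom]) simp

lemma projection_eq_one: "c \<in> tensor_relations A B \<Longrightarrow> K #>\<^bsub>F\<^esub> c = \<one>\<^bsub>tensor A B\<^esub>"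
  unfolding tensor_def
  using generate.incl[of c "tensor_relations A B" F]
  by (simp add: tensor_kernel_def FactGroup_def flip: tensor_kernel_def)
     (metis normal_imp_subgroup normal_kernel group_free_Abelian_group group.coset_join2
        subgroup.mem_carrier tensor_kernel_def)

text \<open>Write u = (u - v - w) + (v + w) and project: the first summand dies. Both families of
  tensor relations have this shape, so additivity in either argument follows from it.\<close>

lemma projection_relation:
  assumes "u \<in> carrier F" "v \<in> carrier F" "w \<in> carrier F" "u - v - w \<in> tensor_relations A B"
  shows "K #>\<^bsub>F\<^esub> u = (K #>\<^bsub>F\<^esub> v) \<otimes>\<^bsub>tensor A B\<^esub> (K #>\<^bsub>F\<^esub> w)"
proof -
  interpret T: comm_group "tensor A B" by (rule comm_group_tensor)
  have "u - v - w \<in> carrier F" using relations_closed assms(4) by blast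
  moreover have "v + w \<in> carrier F"
    using assms(2,3) group.is_monoid[OF group_free_Abelian_group]
    by (metis monoid.m_closed mult_free_Abelian_group)
  ultimately have "K #>\<^bsub>F\<^esub> (u - v - w + (v + w)) = (K #>\<^bsub>F\<^esub> (u - v - w)) \<otimes>\<^bsub>tensor A B\<^esub> (K #>\<^bsub>F\<^esub> (v + w))"
    using hom_mult[OF projection_hom] by (metis mult_free_Abelian_group)
  also have "\<dots> = K #>\<^bsub>F\<^esub> (v + w)"
    using projection_eq_one[OF assms(4)] hom_in_carrier[OF projection_hom \<open>v + w \<in> carrier F\<close>]
    by simp
  also have "\<dots> = (K #>\<^bsub>F\<^esub> v) \<otimes>\<^bsub>tensor A B\<^esub> (K #>\<^bsub>F\<^esub> w)"
    using hom_mult[OF projection_hom assms(2,3)] by simp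
  finally show ?thesis by simp
qed

lemma biadditive_pure_tensor: "biadditive A B (tensor A B) (pure_tensor A B)"
proof (rule biadditiveI)
  fix a a' b assume "a \<in> carrier A" "a' \<in> carrier A" "b \<in> carrier B"
  then show "pure_tensor A B (a \<otimes>\<^bsub>A\<^esub> a') b = pure_tensor A B a b \<otimes>\<^bsub>tensor A B\<^esub> pure_tensor A B a' b"
    unfolding pure_tensor_def
    by (intro projection_relation) (auto simp: tensor_relations_def)
next
  fix a b b' assume "a \<in> carrier A" "b \<in> carrier B" "b' \<in> carrier B"
  then show "pure_tensor A B a (b \<otimes>\<^bsub>B\<^esub> b') = pure_tensor A B a b \<otimes>\<^bsub>tensor A B\<^esub> pure_tensor A B a b'"
    unfolding pure_tensor_def
    by (intro projection_relation) (auto simp: tensor_relations_def)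
qed simp

lemmas group_tensor = comm_group.axioms(2)[OF comm_group_tensor]

lemmas pure_tensor_mult = biadditiveD(2,3)[OF biadditive_pure_tensor]

lemmas pure_tensor_group =
  biadditive_group[OF A.is_group B.is_group group_tensor biadditive_pure_tensor]

text \<open>No case for inverses is required, because the inverse of a pure tensor is again pure:
  the inverse moves into the first factor.\<close>

lemma tensor_induct [consumes 1, case_names pure mult]:
  assumes "t \<in> carrier (tensor A B)"
    and pure: "\<And>a b. a \<in> carrier A \<Longrightarrow> b \<in> carrier B \<Longrightarrow> P (pure_tensor A B a b)"
    and mult: "\<And>s t. s \<in> carrier (tensor A B) \<Longrightarrow> t \<in> carrier (tensor A B) \<Longrightarrow> P s \<Longrightarrow> P t \<Longrightarrow>
      P (s \<otimes>\<^bsub>tensor A B\<^esub> t)"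
  shows "P t"
proof -
  interpret T: comm_group "tensor A B" by (rule comm_group_tensor)
  interpret p: group_hom F "tensor A B" "\<lambda>c. K #>\<^bsub>F\<^esub> c"
    by (rule group_hom_if_hom[OF group_free_Abelian_group group_tensor projection_hom])
  obtain c where c: "c \<in> carrier F" "t = K #>\<^bsub>F\<^esub> c"
    using assms(1) by (auto simp: tensor_def FactGroup_def RCOSETS_def)
  \<comment> \<open>Induction on the free Abelian group has a difference step, so the claim is
    strengthened to cover a class together with its inverse.\<close>
  have "P (K #>\<^bsub>F\<^esub> c) \<and> P (inv\<^bsub>tensor A B\<^esub> (K #>\<^bsub>F\<^esub> c))"
  proof (rule free_Abelian_group_induct[of c "carrier A \<times> carrier B"])
    show "Poly_Mapping.keys c \<subseteq> carrier A \<times> carrier B" using c(1) by simp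
    have "P (pure_tensor A B \<one>\<^bsub>A\<^esub> \<one>\<^bsub>B\<^esub>)" by (rule pure) auto
    then show "P (K #>\<^bsub>F\<^esub> 0) \<and> P (inv\<^bsub>tensor A B\<^esub> (K #>\<^bsub>F\<^esub> 0))"
      using p.hom_one pure_tensor_group(1)[of "\<one>\<^bsub>B\<^esub>"] by simp
  next
    fix x y :: "'a \<times> 'b \<Rightarrow>\<^sub>0 int"
    assume xy: "Poly_Mapping.keys x \<subseteq> carrier A \<times> carrier B" "Poly_Mapping.keys y \<subseteq> carrier A \<times> carrier B"
      and P: "P (K #>\<^bsub>F\<^esub> x) \<and> P (inv\<^bsub>tensor A B\<^esub> (K #>\<^bsub>F\<^esub> x))"
        "P (K #>\<^bsub>F\<^esub> y) \<and> P (inv\<^bsub>tensor A B\<^esub> (K #>\<^bsub>F\<^esub> y))"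
    have c: "K #>\<^bsub>F\<^esub> x \<in> carrier (tensor A B)" "K #>\<^bsub>F\<^esub> y \<in> carrier (tensor A B)"
      using xy by (auto intro!: p.hom_closed)
    have "K #>\<^bsub>F\<^esub> (x - y) = (K #>\<^bsub>F\<^esub> x) \<otimes>\<^bsub>tensor A B\<^esub> inv\<^bsub>tensor A B\<^esub> (K #>\<^bsub>F\<^esub> y)"
      using p.hom_mult[of x "- y"] p.hom_inv[of y] xy by simp
    then show "P (K #>\<^bsub>F\<^esub> (x - y)) \<and> P (inv\<^bsub>tensor A B\<^esub> (K #>\<^bsub>F\<^esub> (x - y)))"
      using P c by (auto intro!: mult simp: T.inv_mult_group)
  next
    fix ab assume "ab \<in> carrier A \<times> carrier B"
    then obtain a b where ab: "ab = (a, b)" "a \<in> carrier A" "b \<in> carrier B" by auto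
    show "P (K #>\<^bsub>F\<^esub> frag_of ab) \<and> P (inv\<^bsub>tensor A B\<^esub> (K #>\<^bsub>F\<^esub> frag_of ab))"
      using pure[of a b] pure[of "inv\<^bsub>A\<^esub> a" b] pure_tensor_group(3)[of a b] ab
      by (simp flip: pure_tensor_def)
  qed
  then show ?thesis using c(2) by simp
qed

lemma tensor_hom_eqI:
  assumes "h \<in> hom (tensor A B) C" "k \<in> hom (tensor A B) C"
    and "\<And>a b. a \<in> carrier A \<Longrightarrow> b \<in> carrier B \<Longrightarrow> h (pure_tensor A B a b) = k (pure_tensor A B a b)"
    and "t \<in> carrier (tensor A B)"
  shows "h t = k t"
  using assms(4) by (induction rule: tensor_induct) (use assms in \<open>auto simp: hom_mult\<close>)

text \<open>Extend \<open>f\<close> from generators to the free Abelian group; biadditivity puts the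
  relations into the kernel, so the extension factors through the quotient. Uniqueness is
  \<open>tensor_hom_eqI\<close>.\<close>

lemma tensor_universal:
  assumes "comm_group C" and f: "biadditive A B C f"
  shows "\<exists>h \<in> hom (tensor A B) C. \<forall>a \<in> carrier A. \<forall>b \<in> carrier B. h (pure_tensor A B a b) = f a b"
proof -
  interpret C: comm_group C by fact
  obtain h where h: "h \<in> hom F C" "\<And>ab. ab \<in> carrier A \<times> carrier B \<Longrightarrow> h (frag_of ab) = case_prod f ab"
  proof (rule C.free_Abelian_group_universal[of "case_prod f" "carrier A \<times> carrier B"])
    show "case_prod f ` (carrier A \<times> carrier B) \<subseteq> carrier C" using biadditiveD(1)[OF f] by auto
  qed (rule that)
  interpret h: group_hom F C h
    by (rule group_hom_if_hom[OF group_free_Abelian_group C.is_group h(1)])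
  have diff: "h (x - y) = h x \<otimes>\<^bsub>C\<^esub> inv\<^bsub>C\<^esub> h y" if "x \<in> carrier F" "y \<in> carrier F" for x y
    using h.hom_mult[of x "- y"] h.hom_inv[of y] that by simp
  have diff_closed: "x - y \<in> carrier F" if "x \<in> carrier F" "y \<in> carrier F" for x y
    using that keys_diff[of x y] by auto
  have rel: "h c = \<one>\<^bsub>C\<^esub>" if "c \<in> tensor_relations A B" for c
  proof -
    have *: "h (frag_of u - frag_of v - frag_of w) = \<one>\<^bsub>C\<^esub>"
      if "u \<in> carrier A \<times> carrier B" "v \<in> carrier A \<times> carrier B" "w \<in> carrier A \<times> carrier B"
        "case_prod f u = case_prod f v \<otimes>\<^bsub>C\<^esub> case_prod f w" for u v w
    proof -
      have cl: "case_prod f x \<in> carrier C" if "x \<in> carrier A \<times> carrier B" for x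
        using that biadditiveD(1)[OF f] by auto
      have fr: "frag_of u \<in> carrier F" "frag_of v \<in> carrier F" "frag_of w \<in> carrier F"
        using that by auto
      have "h (frag_of u - frag_of v - frag_of w) =
          case_prod f u \<otimes>\<^bsub>C\<^esub> inv\<^bsub>C\<^esub> case_prod f v \<otimes>\<^bsub>C\<^esub> inv\<^bsub>C\<^esub> case_prod f w"
        by (simp only: diff fr diff_closed h(2) that)
      also have "\<dots> = \<one>\<^bsub>C\<^esub>"
        using cl[OF that(2)] cl[OF that(3)] unfolding that(4)
        by (simp only: C.m_comm[of "case_prod f v"] C.m_assoc C.r_inv C.r_one C.inv_closed C.m_closed)
      finally show ?thesis .
    qed
    from that show ?thesis
      unfolding tensor_relations_def
    proof (elim UnE CollectE exE conjE, goal_cases)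
      case (1 a a' b)
      then show ?case using *[of "(a \<otimes>\<^bsub>A\<^esub> a', b)" "(a, b)" "(a', b)"] biadditiveD(2)[OF f] by simp
    next
      case (2 a b b')
      then show ?case using *[of "(a, b \<otimes>\<^bsub>B\<^esub> b')" "(a, b)" "(a, b')"] biadditiveD(3)[OF f] by simp
    qed
  qed
  have "tensor_relations A B \<subseteq> kernel F C h"
    using rel relations_closed by (auto simp only: kernel_def)
  then have "K \<subseteq> kernel F C h"
    unfolding tensor_kernel_def
    by (rule group.generate_subgroup_incl[OF group_free_Abelian_group _ h.subgroup_kernel])
  then obtain g where g: "g \<in> hom (F Mod K) C" "\<And>x. x \<in> carrier F \<Longrightarrow> g (K #>\<^bsub>F\<^esub> x) = h x"
    using h.FactGroup_universal_kernel[OF normal_kernel] by blast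
  show ?thesis
    by (rule bexI[of _ g]) (use g h(2) in \<open>auto simp: tensor_def pure_tensor_def\<close>)
qed

lemma tensor_lift:
  assumes "comm_group C" "biadditive A B C f"
  shows "tensor_lift A B C f \<in> hom (tensor A B) C"
    and "a \<in> carrier A \<Longrightarrow> b \<in> carrier B \<Longrightarrow> tensor_lift A B C f (pure_tensor A B a b) = f a b"
  using someI_ex[OF tensor_universal[OF assms, unfolded Bex_def]]
  unfolding tensor_lift_def by blast+

end


text \<open>The form is built by lifting twice: for fixed m and r the map \<open>g m r\<close>
  extends the form over the second factor, and for fixed y the map (m, r) \<mapsto>
  \<open>g m r y\<close> is biadditive and extends over the first. This shows that the choice in
  \<open>base_change\<close> picks something. It is stated for any ring because both the reals and
  F_2 are needed.\<close>

lemma base_change: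
  fixes L :: "('l, 'x) monoid_scheme" and J :: "'l \<Rightarrow> 'l \<Rightarrow> int"
  defines "R \<equiv> additive_group :: 'r::comm_ring_1 monoid"
  assumes L: "comm_group L" and J: "biadditive L L additive_group J"
  shows "biadditive (tensor L R) (tensor L R) R (base_change L J)"
    and "m \<in> carrier L \<Longrightarrow> n \<in> carrier L \<Longrightarrow>
      base_change L J (pure_tensor L R m r) (pure_tensor L R n s) = of_int (J m n) * (r * s)"
proof -
  have R: "comm_group R" by (simp add: R_def)
  interpret comm_group_pair L R using L R by (simp add: comm_group_pair_def)
  have R_simps [simp]: "carrier R = UNIV" "r \<otimes>\<^bsub>R\<^esub> s = r + s" for r s by (simp_all add: R_def)
  define g where "g m r = tensor_lift L R R (\<lambda>n s. of_int (J m n) * (r * s))" for m r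
  have J_add [simp]: "J (m \<otimes>\<^bsub>L\<^esub> m') n = J m n + J m' n" "J n (m \<otimes>\<^bsub>L\<^esub> m') = J n m + J n m'"
    if "m \<in> carrier L" "m' \<in> carrier L" "n \<in> carrier L" for m m' n
    using biadditiveD(2,3)[OF J] that by simp_all
  have "biadditive L R R (\<lambda>n s. of_int (J m n) * (r * s))" if "m \<in> carrier L" for m r
    by (rule biadditiveI) (use that in \<open>simp_all add: algebra_simps\<close>)
  note g = tensor_lift[OF R this, folded g_def]
  have sum_hom: "(\<lambda>t. h t + k t) \<in> hom (tensor L R) R"
    if "h \<in> hom (tensor L R) R" "k \<in> hom (tensor L R) R" for h k
    using that by (auto simp: hom_def)
  have g_biadd: "biadditive L R R (\<lambda>m r. g m r y)" if "y \<in> carrier (tensor L R)" for y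
  proof (rule biadditiveI)
    fix m m' r assume "m \<in> carrier L" "m' \<in> carrier L"
    then show "g (m \<otimes>\<^bsub>L\<^esub> m') r y = g m r y \<otimes>\<^bsub>R\<^esub> g m' r y"
      using tensor_hom_eqI[OF g(1) sum_hom[OF g(1) g(1)] _ that, of "m \<otimes>\<^bsub>L\<^esub> m'" m m' r r r]
      by (simp add: g algebra_simps)
  next
    fix m r r' assume "m \<in> carrier L"
    then show "g m (r \<otimes>\<^bsub>R\<^esub> r') y = g m r y \<otimes>\<^bsub>R\<^esub> g m r' y"
      using tensor_hom_eqI[OF g(1) sum_hom[OF g(1) g(1)] _ that, of m m m "r + r'" r r']
      by (simp add: g algebra_simps)
  qed simp
  define \<beta> where "\<beta> x y = tensor_lift L R R (\<lambda>m r. g m r y) x" for x y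
  have \<beta>_hom: "(\<lambda>x. \<beta> x y) \<in> hom (tensor L R) R" if "y \<in> carrier (tensor L R)" for y
    using tensor_lift(1)[OF R g_biadd[OF that]] by (simp add: \<beta>_def)
  have \<beta>_pure: "\<beta> (pure_tensor L R m r) y = g m r y"
    if "y \<in> carrier (tensor L R)" "m \<in> carrier L" for y m r
    using tensor_lift(2)[OF R g_biadd] that by (simp add: \<beta>_def)
  \<comment> \<open>The second lift only yields additivity in x. Additivity in y compares two
    homomorphisms in x, which agree as soon as they agree on pure tensors.\<close>
  have "\<beta> x (y \<otimes>\<^bsub>tensor L R\<^esub> y') = \<beta> x y + \<beta> x y'"
    if x: "x \<in> carrier (tensor L R)" and y: "y \<in> carrier (tensor L R)" "y' \<in> carrier (tensor L R)" for x y y'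
  proof (rule tensor_hom_eqI[OF \<beta>_hom[of "y \<otimes>\<^bsub>tensor L R\<^esub> y'"] sum_hom[OF \<beta>_hom[of y] \<beta>_hom[of y']] _ x])
    fix m r assume "m \<in> carrier L"
    then show "\<beta> (pure_tensor L R m r) (y \<otimes>\<^bsub>tensor L R\<^esub> y') = \<beta> (pure_tensor L R m r) y + \<beta> (pure_tensor L R m r) y'"
      using hom_mult[OF g(1) y] y by (simp add: \<beta>_pure comm_group.axioms(2)[OF comm_group_tensor] group.subgroup_self subgroup.m_closed)
  qed (use y in \<open>auto simp: comm_group.axioms(2)[OF comm_group_tensor] group.subgroup_self subgroup.m_closed\<close>)
  then have "biadditive (tensor L R) (tensor L R) R \<beta>"
    using hom_mult[OF \<beta>_hom] by (intro biadditiveI) auto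
  moreover have "\<beta> (pure_tensor L R m r) (pure_tensor L R n s) = of_int (J m n) * (r * s)"
    if "m \<in> carrier L" "n \<in> carrier L" for m n r s
    using that by (simp add: \<beta>_pure g)
  ultimately have ex: "\<exists>\<beta>. biadditive (tensor L R) (tensor L R) R \<beta> \<and>
      (\<forall>m \<in> carrier L. \<forall>n \<in> carrier L. \<forall>r s.
        \<beta> (pure_tensor L R m r) (pure_tensor L R n s) = of_int (J m n) * (r * s))"
    by blast
  from someI_ex[OF ex]
  show "biadditive (tensor L R) (tensor L R) R (base_change L J)"
    and "m \<in> carrier L \<Longrightarrow> n \<in> carrier L \<Longrightarrow>
      base_change L J (pure_tensor L R m r) (pure_tensor L R n s) = of_int (J m n) * (r * s)"
    by (simp_all add: base_change_def R_def)
qed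

text \<open>A biadditive map is a normalised 2-cocycle: in both bracketings of a triple product the
  total sign is c(a, b) c(a, d) c(b, d).\<close>

lemma group_sign_extension:
  assumes A: "group A" and c: "biadditive A A sign_group c"
  shows "group (sign_extension A c)"
proof -
  interpret A: group A by fact
  have sign: "c a b = 1 \<or> c a b = -1" if "a \<in> carrier A" "b \<in> carrier A" for a b
    using biadditiveD(1)[OF c that] by simp
  have add: "c (a \<otimes>\<^bsub>A\<^esub> a') b = c a b * c a' b" "c b (a \<otimes>\<^bsub>A\<^esub> a') = c b a * c b a'"
    if "a \<in> carrier A" "a' \<in> carrier A" "b \<in> carrier A" for a a' b
    using biadditiveD(2,3)[OF c] that by simp_all
  have one: "c \<one>\<^bsub>A\<^esub> a = 1" if "a \<in> carrier A" for a
    using biadditive_group(1)[OF A A comm_group.axioms(2) c that] by simp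
  show ?thesis
  proof (rule groupI)
    fix x assume "x \<in> carrier (sign_extension A c)"
    then obtain a \<epsilon> where x: "x = (a, \<epsilon>)" "a \<in> carrier A" "\<epsilon> = 1 \<or> \<epsilon> = -1"
      by (auto simp: sign_extension_def)
    then show "\<exists>y\<in>carrier (sign_extension A c). y \<otimes>\<^bsub>sign_extension A c\<^esub> x = \<one>\<^bsub>sign_extension A c\<^esub>"
      using sign[of "inv\<^bsub>A\<^esub> a" a]
      \<comment> \<open>The product with x contributes c(a, b) at a the inverse of b; the witness
        carries the same sign, and its square is 1.\<close>
      by (intro bexI[of _ "(inv\<^bsub>A\<^esub> a, \<epsilon> * c (inv\<^bsub>A\<^esub> a) a)"]) (auto simp: sign_extension_def)
  next
    fix x y assume "x \<in> carrier (sign_extension A c)" "y \<in> carrier (sign_extension A c)"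
    then show "x \<otimes>\<^bsub>sign_extension A c\<^esub> y \<in> carrier (sign_extension A c)"
      using sign[of "fst x" "fst y"] by (auto simp: sign_extension_def)
  next
    fix x y z assume "x \<in> carrier (sign_extension A c)" "y \<in> carrier (sign_extension A c)"
      "z \<in> carrier (sign_extension A c)"
    then show "x \<otimes>\<^bsub>sign_extension A c\<^esub> y \<otimes>\<^bsub>sign_extension A c\<^esub> z =
        x \<otimes>\<^bsub>sign_extension A c\<^esub> (y \<otimes>\<^bsub>sign_extension A c\<^esub> z)"
      by (cases x; cases y; cases z) (simp add: sign_extension_def A.m_assoc add)
  qed (auto simp: sign_extension_def one)
qed

section \<open>Strict categorical groups and their fixed points\<close>

locale strict_cat_group =
  fixes C :: "('o, 'a, 'x) strict_monoidal_category_scheme"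
  assumes strict_categorical_group: "strict_categorical_group C"
begin

lemma object_group_simps [simp]:
  "carrier (object_group C) = Obj C" "x \<otimes>\<^bsub>object_group C\<^esub> y = Tobj C x y"
  "\<one>\<^bsub>object_group C\<^esub> = Tunit C"
  by (simp_all add: object_group_def)

lemma arrow_group_simps [simp]:
  "carrier (arrow_group C) = Arr C" "f \<otimes>\<^bsub>arrow_group C\<^esub> g = Tarr C f g"
  "\<one>\<^bsub>arrow_group C\<^esub> = Ident C (Tunit C)"
  by (simp_all add: arrow_group_def)

sublocale O: group "object_group C"
  using strict_categorical_group by (simp add: strict_categorical_group_def)

sublocale A: group "arrow_group C"
  using strict_categorical_group by (simp add: strict_categorical_group_def)

abbreviation inv_obj :: "'o \<Rightarrow> 'o" where "inv_obj x \<equiv> inv\<^bsub>object_group C\<^esub> x"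
abbreviation inv_arr :: "'a \<Rightarrow> 'a" where "inv_arr f \<equiv> inv\<^bsub>arrow_group C\<^esub> f"

sublocale src: group_hom "arrow_group C" "object_group C" "Src C"
  using strict_categorical_group
  by unfold_locales (simp add: strict_categorical_group_def)

sublocale tgt: group_hom "arrow_group C" "object_group C" "Tgt C"
  using strict_categorical_group
  by unfold_locales (simp add: strict_categorical_group_def)

sublocale ident: group_hom "object_group C" "arrow_group C" "Ident C"
  using strict_categorical_group
  by unfold_locales (simp add: strict_categorical_group_def)

declare ident.hom_mult [simp del] ident.hom_inv [simp del]

text \<open>The homomorphism laws of \<open>Ident\<close> are used in reverse, which is why their
  forward forms were removed: products and inverses of identity arrows collapse to one identity
  arrow.\<close>

lemmas tensor_simps [simp] =
  O.m_closed[simplified] O.l_one[simplified] O.r_one[simplified] O.l_inv[simplified] O.r_inv[simplified]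
  O.one_closed[simplified] O.inv_closed[simplified]
  A.m_closed[simplified] A.l_one[simplified] A.r_one[simplified] A.l_inv[simplified] A.r_inv[simplified]
  A.one_closed[simplified] A.inv_closed[simplified]
  src.hom_closed[simplified] src.hom_mult[simplified] src.hom_inv[simplified]
  tgt.hom_closed[simplified] tgt.hom_mult[simplified] tgt.hom_inv[simplified]
  ident.hom_closed[simplified] ident.hom_mult[simplified, symmetric] ident.hom_inv[simplified, symmetric]

lemmas tensor_assoc = O.m_assoc[simplified] A.m_assoc[simplified]

lemma is_category: "is_category C"
  using strict_categorical_group by (simp add: strict_categorical_group_def)

lemma ident_simps [simp]:
  "x \<in> Obj C \<Longrightarrow> Src C (Ident C x) = x" "x \<in> Obj C \<Longrightarrow> Tgt C (Ident C x) = x"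
  using is_category by (simp_all add: is_category_def)

lemma comp_simps [simp]:
  assumes "f \<in> Arr C" "g \<in> Arr C" "Tgt C g = Src C f"
  shows "Comp C f g \<in> Arr C" "Src C (Comp C f g) = Src C g" "Tgt C (Comp C f g) = Tgt C f"
  using is_category assms by (simp_all add: is_category_def)

lemma comp_ident [simp]:
  assumes "f \<in> Arr C"
  shows "x = Src C f \<Longrightarrow> Comp C f (Ident C x) = f" "x = Tgt C f \<Longrightarrow> Comp C (Ident C x) f = f"
  using is_category assms by (simp_all add: is_category_def)

lemma comp_assoc:
  assumes "f \<in> Arr C" "g \<in> Arr C" "h \<in> Arr C" "Tgt C h = Src C g" "Tgt C g = Src C f"
  shows "Comp C f (Comp C g h) = Comp C (Comp C f g) h"
  using is_category assms by (simp add: is_category_def)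

lemma interchange:
  assumes "f \<in> Arr C" "g \<in> Arr C" "f' \<in> Arr C" "g' \<in> Arr C" "Tgt C g = Src C f" "Tgt C g' = Src C f'"
  shows "Comp C (Tarr C f f') (Tarr C g g') = Tarr C (Comp C f g) (Comp C f' g')"
  using strict_categorical_group assms by (simp add: strict_categorical_group_def)

text \<open>By interchange, the composite of the tensor inverses is a left tensor inverse of the
  composite. This provides the inverses of equivariant objects and arrows.\<close>

lemma comp_inv_arr:
  assumes "f \<in> Arr C" "g \<in> Arr C" "Tgt C g = Src C f"
  shows "Comp C (inv_arr f) (inv_arr g) = inv_arr (Comp C f g)"
proof (rule sym, rule A.inv_equality)
  show "Comp C (inv_arr f) (inv_arr g) \<otimes>\<^bsub>arrow_group C\<^esub> Comp C f g = \<one>\<^bsub>arrow_group C\<^esub>"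
    using assms by (simp flip: interchange)
qed (use assms in simp_all)

text \<open>The group structure inverts arrows for composition as well: the inverse of f from x to y
  is the product of the identity of y, the tensor inverse of f and the identity of x. Invertibility
  of the structure arrows of an equivariant object thus comes for free.\<close>

lemma is_isoarrow_iff [simp]: "is_isoarrow C f \<longleftrightarrow> f \<in> Arr C"
proof
  assume f: "f \<in> Arr C"
  let ?x = "Src C f" and ?y = "Tgt C f"
  let ?g = "Tarr C (Ident C ?y) (Tarr C (inv_arr f) (Ident C ?x))"
  \<comment> \<open>Here f is padded on the right, and in \<open>f2\<close> on the left, by a
    trivial product of identities. Then f and \<open>?g\<close> are threefold products whose factors
    are composable one by one, and interchange applies.\<close>
  have f1: "Tarr C f (Tarr C (Ident C (inv_obj ?x)) (Ident C ?x)) = f" using f by simp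
  have "Tarr C (Ident C ?y) (Tarr C (Ident C (inv_obj ?y)) f) =
      Tarr C (Tarr C (Ident C ?y) (Ident C (inv_obj ?y))) f"
    using f tensor_assoc(2)[of "Ident C ?y" "Ident C (inv_obj ?y)" f] by simp
  then have f2: "Tarr C (Ident C ?y) (Tarr C (Ident C (inv_obj ?y)) f) = f" using f by simp
  have "Comp C ?g f = Tarr C f (Tarr C (inv_arr f) (Ident C ?x))"
    using f interchange[of "Ident C ?y" f "Tarr C (inv_arr f) (Ident C ?x)" "Tarr C (Ident C (inv_obj ?x)) (Ident C ?x)"]
      interchange[of "inv_arr f" "Ident C (inv_obj ?x)" "Ident C ?x" "Ident C ?x"]
    by (simp add: f1)
  then have gf: "Comp C ?g f = Ident C ?x"
    using f tensor_assoc(2)[of f "inv_arr f" "Ident C ?x"] by simp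
  have "Comp C f ?g = Tarr C (Ident C ?y) (Tarr C (inv_arr f) f)"
    using f interchange[of "Ident C ?y" "Ident C ?y" "Tarr C (Ident C (inv_obj ?y)) f" "Tarr C (inv_arr f) (Ident C ?x)"]
      interchange[of "Ident C (inv_obj ?y)" "inv_arr f" f "Ident C ?x"]
    by (simp add: f2)
  then have fg: "Comp C f ?g = Ident C ?y" using f by simp
  have "?g \<in> Arr C" "Src C ?g = ?y" "Tgt C ?g = ?x"
    using f O.m_assoc[of ?y "inv_obj ?y" ?x] by simp_all
  with f gf fg show "is_isoarrow C f" unfolding is_isoarrow_def by blast
qed (simp add: is_isoarrow_def)

text \<open>The Eckmann--Hilton argument behind the Peiffer identity.\<close>

lemma kernels_commute:
  assumes "u \<in> Arr C" "Src C u = Tunit C" "v \<in> Arr C" "Tgt C v = Tunit C"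
  shows "Tarr C u v = Tarr C v u"
proof -
  let ?e = "Ident C (Tunit C)"
  have "Comp C u v = Tarr C u v" using interchange[of u ?e ?e v] assms by simp
  moreover have "Comp C u v = Tarr C v u" using interchange[of ?e v u ?e] assms by simp
  ultimately show ?thesis by simp
qed

text \<open>After reassociating to the right, two neighbouring identities are no longer a subterm of
  their own; this rule lets them collapse nevertheless.\<close>

lemma ident_tensor_assoc:
  assumes "x \<in> Obj C" "y \<in> Obj C" "a \<in> Arr C"
  shows "Tarr C (Ident C x) (Tarr C (Ident C y) a) = Tarr C (Ident C (Tobj C x y)) a"
  using assms tensor_assoc(2)[of "Ident C x" "Ident C y" a] by simp

text \<open>Most axioms only express that \<open>Src\<close>, \<open>Tgt\<close> and
  \<open>Ident\<close> are homomorphisms. The Peiffer identity also needs interchange, through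
  \<open>kernels_commute\<close>.\<close>

lemma crossed_module_of: "crossed_module (crossed_module_of C)"
proof -
  define N where "N = kernel (arrow_group C) (object_group C) (Src C)"
  define T where "T = (arrow_group C)\<lparr>carrier := N\<rparr>"
  define act where "act x a = Tarr C (Tarr C (Ident C x) a) (inv_arr (Ident C x))" for x a
  have N: "a \<in> N \<longleftrightarrow> a \<in> Arr C \<and> Src C a = Tunit C" for a by (simp add: N_def kernel_def)
  have sub: "subgroup N (arrow_group C)" unfolding N_def by (rule src.subgroup_kernel)
  have T: "group T" unfolding T_def by (rule A.subgroup_imp_group[OF sub])
  have T_simps [simp]: "carrier T = N" "a \<otimes>\<^bsub>T\<^esub> b = Tarr C a b" "\<one>\<^bsub>T\<^esub> = Ident C (Tunit C)" for a b
    by (simp_all add: T_def)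
  have inv_T [simp]: "inv\<^bsub>T\<^esub> a = inv_arr a" if "a \<in> N" for a
    unfolding T_def using A.m_inv_consistent[OF sub that] .
  have act_closed: "act x a \<in> N" if "x \<in> Obj C" "a \<in> N" for x a
    using that by (simp add: N act_def)
  have act_mult: "act x (Tarr C a b) = Tarr C (act x a) (act x b)"
    if "x \<in> Obj C" "a \<in> Arr C" "b \<in> Arr C" for x a b
    using that by (simp add: act_def tensor_assoc ident_tensor_assoc)
  have act_comp: "act (Tobj C x y) a = act x (act y a)" if "x \<in> Obj C" "y \<in> Obj C" "a \<in> Arr C" for x y a
    using that O.inv_mult_group[of x y] by (simp add: act_def tensor_assoc ident_tensor_assoc)
  have act_one: "act (Tunit C) a = a" if "a \<in> Arr C" for a
    using that O.inv_one by (simp add: act_def)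
  have act_iso: "act x \<in> iso T T" if x: "x \<in> Obj C" for x
  proof (rule isoI)
    show "act x \<in> hom T T"
      using x by (intro homI) (simp_all add: act_closed, simp add: act_mult N)
    show "bij_betw (act x) (carrier T) (carrier T)"
    proof (rule bij_betw_byWitness[where f' = "act (inv_obj x)"])
      show "\<forall>a\<in>carrier T. act (inv_obj x) (act x a) = a" "\<forall>a\<in>carrier T. act x (act (inv_obj x) a) = a"
        using x by (auto simp: N act_one simp flip: act_comp)
    qed (use x act_closed in auto)
  qed
  have peiffer: "act (Tgt C s) t = Tarr C (Tarr C s t) (inv_arr s)" if s: "s \<in> N" and t: "t \<in> N" for s t
  proof -
    \<comment> \<open>\<open>s\<close> differs from the identity of its target by an arrow \<open>v\<close> into the unit, which commutes with \<open>t\<close>\<close>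
    define v where "v = Tarr C (inv_arr s) (Ident C (Tgt C s))"
    have v: "v \<in> Arr C" "Tgt C v = Tunit C" using s by (simp_all add: v_def N)
    have id: "Ident C (Tgt C s) = Tarr C s v"
      using s A.inv_solve_left'[of v s "Ident C (Tgt C s)"] by (simp add: v_def N)
    have "act (Tgt C s) t = Tarr C (Tarr C (Tarr C s v) t) (inv_arr (Tarr C s v))"
      using s by (simp add: act_def N flip: id)
    also have "\<dots> = Tarr C s (Tarr C (Tarr C v t) (Tarr C (inv_arr v) (inv_arr s)))"
      using s t v A.inv_mult_group[of s v] by (simp add: N tensor_assoc)
    also have "Tarr C v t = Tarr C t v"
      using kernels_commute[of t v] t v by (simp add: N)
    also have "Tarr C s (Tarr C (Tarr C t v) (Tarr C (inv_arr v) (inv_arr s))) = Tarr C (Tarr C s t) (inv_arr s)"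
      using s t v tensor_assoc(2)[of v "inv_arr v" "inv_arr s"] by (simp add: N tensor_assoc)
    finally show ?thesis .
  qed
  have M: "crossed_module_of C = \<lparr>Base = object_group C, Top = T, Boundary = Tgt C, Act = act\<rparr>"
    by (simp add: crossed_module_of_def T_def N_def act_def fun_eq_iff)
  have "Tgt C \<in> hom T (object_group C)"
    by (rule homI) (simp_all add: N)
  moreover have "Tgt C (act x a) = Tobj C (Tobj C x (Tgt C a)) (inv_obj x)" if "x \<in> Obj C" "a \<in> N" for x a
    using that by (simp add: act_def N)
  ultimately show ?thesis
    unfolding crossed_module_def M using T O.is_group N act_iso act_one act_comp peiffer by simp
qed

end

section \<open>Equivariant objects and arrows of a strict monoidal action\<close>

locale strict_cat_group_action = strict_cat_group C
  for C :: "('o, 'a, 'x) strict_monoidal_category_scheme" +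
  fixes G :: "('g, 'y) monoid_scheme" and \<rho> :: "'g \<Rightarrow> ('o, 'a, 'o, 'a) cat_map"
  assumes action: "strict_monoidal_action G C \<rho>"
begin

abbreviation "EO \<equiv> equivariant_objects G C \<rho>"
abbreviation "EA \<equiv> equivariant_arrows G C \<rho>"

sublocale G: group G using action by (simp add: strict_monoidal_action_def)

lemma functor_simps [simp]:
  assumes g: "g \<in> carrier G"
  shows "x \<in> Obj C \<Longrightarrow> Fobj (\<rho> g) x \<in> Obj C"
    and "x \<in> Obj C \<Longrightarrow> Farr (\<rho> g) (Ident C x) = Ident C (Fobj (\<rho> g) x)"
    and "f \<in> Arr C \<Longrightarrow> Farr (\<rho> g) f \<in> Arr C"
    and "f \<in> Arr C \<Longrightarrow> Src C (Farr (\<rho> g) f) = Fobj (\<rho> g) (Src C f)"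
    and "f \<in> Arr C \<Longrightarrow> Tgt C (Farr (\<rho> g) f) = Fobj (\<rho> g) (Tgt C f)"
    and "f \<in> Arr C \<Longrightarrow> f' \<in> Arr C \<Longrightarrow> Tgt C f' = Src C f \<Longrightarrow>
      Farr (\<rho> g) (Comp C f f') = Comp C (Farr (\<rho> g) f) (Farr (\<rho> g) f')"
    and "Fobj (\<rho> g) (Tunit C) = Tunit C"
    and "x \<in> Obj C \<Longrightarrow> y \<in> Obj C \<Longrightarrow> Fobj (\<rho> g) (Tobj C x y) = Tobj C (Fobj (\<rho> g) x) (Fobj (\<rho> g) y)"
    and "f \<in> Arr C \<Longrightarrow> f' \<in> Arr C \<Longrightarrow> Farr (\<rho> g) (Tarr C f f') = Tarr C (Farr (\<rho> g) f) (Farr (\<rho> g) f')"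
  using action g
  by (simp_all add: strict_monoidal_action_def strict_monoidal_functor_def is_functor_def)

lemma functor_comp [simp]:
  assumes "g \<in> carrier G" "h \<in> carrier G" "x \<in> Obj C"
  shows "Fobj (\<rho> g) (Fobj (\<rho> h) x) = Fobj (\<rho> (g \<otimes>\<^bsub>G\<^esub> h)) x"
  using action assms by (simp add: strict_monoidal_action_def)

lemma functor_inv [simp]:
  assumes g: "g \<in> carrier G"
  shows "x \<in> Obj C \<Longrightarrow> Fobj (\<rho> g) (inv_obj x) = inv_obj (Fobj (\<rho> g) x)"
    and "f \<in> Arr C \<Longrightarrow> Farr (\<rho> g) (inv_arr f) = inv_arr (Farr (\<rho> g) f)"
proof -
  have "Fobj (\<rho> g) \<in> hom (object_group C) (object_group C)"
    and "Farr (\<rho> g) \<in> hom (arrow_group C) (arrow_group C)"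
    by (rule homI; use g in simp)+
  then show "x \<in> Obj C \<Longrightarrow> Fobj (\<rho> g) (inv_obj x) = inv_obj (Fobj (\<rho> g) x)"
    and "f \<in> Arr C \<Longrightarrow> Farr (\<rho> g) (inv_arr f) = inv_arr (Farr (\<rho> g) f)"
    by (auto intro!: group_hom.hom_inv[OF group_hom_if_hom] O.is_group A.is_group)
qed

lemma EO_D:
  assumes "(x, e) \<in> EO"
  shows "x \<in> Obj C" "e \<in> extensional (carrier G)"
    and "g \<in> carrier G \<Longrightarrow> e g \<in> Arr C"
    and "g \<in> carrier G \<Longrightarrow> Src C (e g) = x" "g \<in> carrier G \<Longrightarrow> Tgt C (e g) = Fobj (\<rho> g) x"
    and "g \<in> carrier G \<Longrightarrow> h \<in> carrier G \<Longrightarrow> Comp C (Farr (\<rho> g) (e h)) (e g) = e (g \<otimes>\<^bsub>G\<^esub> h)"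
  using assms by (auto simp: equivariant_objects_def)

lemma EA_D:
  assumes "((x, e), a, (y, f)) \<in> EA"
  shows "(x, e) \<in> EO" "(y, f) \<in> EO" "a \<in> Arr C" "Src C a = x" "Tgt C a = y"
    and "g \<in> carrier G \<Longrightarrow> Comp C (f g) a = Comp C (Farr (\<rho> g) a) (e g)"
  using assms by (auto simp: equivariant_arrows_def)

text \<open>Since all arrows are invertible, only the cocycle condition has content, and interchange
  computes it factor by factor.\<close>

lemma EO_tensor:
  assumes x: "(x, e) \<in> EO" and y: "(y, f) \<in> EO"
  shows "(Tobj C x y, \<lambda>g \<in> carrier G. Tarr C (e g) (f g)) \<in> EO"
  using EO_D[OF x] EO_D[OF y]
  by (simp add: equivariant_objects_def interchange)

lemma EO_unit: "(Tunit C, \<lambda>g \<in> carrier G. Ident C (Tunit C)) \<in> EO"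
  by (simp add: equivariant_objects_def)

lemma EO_inv:
  assumes x: "(x, e) \<in> EO"
  shows "(inv_obj x, \<lambda>g \<in> carrier G. inv_arr (e g)) \<in> EO"
  using EO_D[OF x]
  by (simp add: equivariant_objects_def comp_inv_arr)

lemma EA_tensor:
  assumes a: "((x, e), a, (y, f)) \<in> EA" and a': "((x', e'), a', (y', f')) \<in> EA"
  shows "((Tobj C x x', \<lambda>g \<in> carrier G. Tarr C (e g) (e' g)), Tarr C a a',
    (Tobj C y y', \<lambda>g \<in> carrier G. Tarr C (f g) (f' g))) \<in> EA"
proof -
  note a = EA_D[OF a] and a' = EA_D[OF a']
  show ?thesis
    using a a' EO_D[OF a(1)] EO_D[OF a(2)] EO_D[OF a'(1)] EO_D[OF a'(2)]
    by (simp add: equivariant_arrows_def EO_tensor interchange)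
qed

lemma EA_ident: "(x, e) \<in> EO \<Longrightarrow> ((x, e), Ident C x, (x, e)) \<in> EA"
  using EO_D[of x e] by (simp add: equivariant_arrows_def)

lemma EA_inv:
  assumes a: "((x, e), a, (y, f)) \<in> EA"
  shows "((inv_obj x, \<lambda>g \<in> carrier G. inv_arr (e g)), inv_arr a,
    (inv_obj y, \<lambda>g \<in> carrier G. inv_arr (f g))) \<in> EA"
proof -
  note a = EA_D[OF a]
  show ?thesis
    using a EO_D[OF a(1)] EO_D[OF a(2)]
    by (simp add: equivariant_arrows_def EO_inv comp_inv_arr)
qed

text \<open>The equivariance squares of \<open>a\<close> and \<open>b\<close> are pasted along the
  middle structure arrow.\<close>

lemma EA_comp:
  assumes a: "((x, e), a, (y, f)) \<in> EA" and b: "((y, f), b, (z, h)) \<in> EA"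
  shows "((x, e), Comp C b a, (z, h)) \<in> EA"
proof -
  note a = EA_D[OF a] and b = EA_D[OF b]
  have "Comp C (h g) (Comp C b a) = Comp C (Farr (\<rho> g) (Comp C b a)) (e g)" if g: "g \<in> carrier G" for g
  proof -
    have "Comp C (h g) (Comp C b a) = Comp C (Comp C (Farr (\<rho> g) b) (f g)) a"
      using a b EO_D[OF b(2)] g by (simp add: comp_assoc)
    also have "\<dots> = Comp C (Farr (\<rho> g) b) (Comp C (Farr (\<rho> g) a) (e g))"
      using a b EO_D[OF a(2)] g by (simp flip: comp_assoc)
    also have "\<dots> = Comp C (Farr (\<rho> g) (Comp C b a)) (e g)"
      using a b EO_D[OF a(1)] g by (simp add: comp_assoc)
    finally show ?thesis .
  qed
  then show ?thesis using a b by (simp add: equivariant_arrows_def)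
qed

abbreviation "FP \<equiv> fixed_points G C \<rho>"

lemma fixed_points_simps [simp]:
  "Obj FP = EO" "Arr FP = EA" "Src FP (s, a, t) = s" "Tgt FP (s, a, t) = t"
  "Ident FP (x, e) = ((x, e), Ident C x, (x, e))" "Comp FP (s', a', t') (s, a, t) = (s, Comp C a' a, t')"
  "Tobj FP (x, e) (y, f) = (Tobj C x y, \<lambda>g \<in> carrier G. Tarr C (e g) (f g))"
  "Tarr FP (s, a, t) (s', a', t') = (Tobj FP s s', Tarr C a a', Tobj FP t t')"
  "Tunit FP = (Tunit C, \<lambda>g \<in> carrier G. Ident C (Tunit C))"
  by (simp_all add: fixed_points_def Let_def)

lemma EA_cases:
  assumes "\<alpha> \<in> EA"
  obtains x e a y f where "\<alpha> = ((x, e), a, (y, f))" "((x, e), a, (y, f)) \<in> EA" "(x, e) \<in> EO" "(y, f) \<in> EO"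
    "a \<in> Arr C" "Src C a = x" "Tgt C a = y"
  using assms by (cases \<alpha>) (auto dest: EA_D)

text \<open>Structure families are extensional, so the unit laws of the fixed points hold as
  equalities of functions and not merely on the group.\<close>

lemma restrict_eq: "e \<in> extensional A \<Longrightarrow> (\<And>g. g \<in> A \<Longrightarrow> f g = e g) \<Longrightarrow> restrict f A = e"
  by (auto simp: restrict_def extensional_def fun_eq_iff)

lemma group_EO: "group (object_group FP)"
proof (rule groupI; simp add: object_group_def del: fixed_points_simps(9))
  show "Tunit FP \<in> EO" by (simp add: EO_unit)
next
  fix s assume "s \<in> EO"
  then obtain x e where s: "s = (x, e)" "(x, e) \<in> EO" by (cases s) auto
  note e = EO_D[OF s(2)]
  show "Tobj FP (Tunit FP) s = s"
    using e by (auto simp: s intro!: restrict_eq)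
  show "\<exists>t\<in>EO. Tobj FP t s = Tunit FP"
    using e EO_inv[OF s(2)] by (auto intro!: bexI[of _ "(inv_obj x, \<lambda>g \<in> carrier G. inv_arr (e g))"] restrict_ext simp: s)
next
  fix s t u assume "s \<in> EO" "t \<in> EO" "u \<in> EO"
  then show "Tobj FP (Tobj FP s t) u = Tobj FP s (Tobj FP t u)"
    by (cases s; cases t; cases u) (auto simp: tensor_assoc EO_D(1,3) intro!: restrict_ext)
qed (auto simp: EO_tensor)

lemma group_EA: "group (arrow_group FP)"
proof (rule groupI; simp add: arrow_group_def del: fixed_points_simps(9))
  show "Ident FP (Tunit FP) \<in> EA" by (simp add: EA_ident EO_unit)
next
  fix \<alpha> \<beta> assume "\<alpha> \<in> EA" "\<beta> \<in> EA"
  then show "Tarr FP \<alpha> \<beta> \<in> EA"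
    by (cases \<alpha>; cases \<beta>) (auto simp: EA_tensor)
next
  fix \<alpha> \<beta> \<gamma> assume "\<alpha> \<in> EA" "\<beta> \<in> EA" "\<gamma> \<in> EA"
  then show "Tarr FP (Tarr FP \<alpha> \<beta>) \<gamma> = Tarr FP \<alpha> (Tarr FP \<beta> \<gamma>)"
    by - (erule EA_cases[of \<alpha>], erule EA_cases[of \<beta>], erule EA_cases[of \<gamma>],
      auto simp: tensor_assoc EO_D(1,3) intro!: restrict_ext)
next
  fix \<alpha> assume "\<alpha> \<in> EA"
  then obtain x e a y f where \<alpha>: "\<alpha> = ((x, e), a, (y, f))" "((x, e), a, (y, f)) \<in> EA"
    "(x, e) \<in> EO" "(y, f) \<in> EO" "a \<in> Arr C" by (rule EA_cases)
  note e = EO_D[OF \<alpha>(3)] and f = EO_D[OF \<alpha>(4)]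
  show "Tarr FP (Ident FP (Tunit FP)) \<alpha> = \<alpha>"
    using e f \<alpha> by (auto intro!: restrict_eq)
  show "\<exists>\<beta>\<in>EA. Tarr FP \<beta> \<alpha> = Ident FP (Tunit FP)"
    using e f \<alpha> by (intro bexI[OF _ EA_inv[OF \<alpha>(2)]]) (auto intro!: restrict_ext)
qed

lemma is_category_FP: "is_category FP"
  unfolding is_category_def
  by (auto simp: EA_ident EA_comp comp_assoc EA_D(3-5) dest: EA_D(1,2) EO_D(1))

lemma strict_categorical_group_fixed_points: "strict_categorical_group FP"
proof -
  have "Src FP \<in> hom (arrow_group FP) (object_group FP)" "Tgt FP \<in> hom (arrow_group FP) (object_group FP)"
    by (rule homI; auto simp: arrow_group_def object_group_def dest: EA_D(1,2))+
  moreover have "Ident FP \<in> hom (object_group FP) (arrow_group FP)"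
    by (rule homI) (auto simp: arrow_group_def object_group_def EA_ident EO_D(1) EO_tensor)
  moreover have "Tarr FP (Comp FP f g) (Comp FP f' g') = Comp FP (Tarr FP f f') (Tarr FP g g')"
    if "f \<in> EA" "g \<in> EA" "f' \<in> EA" "g' \<in> EA" "Tgt FP g = Src FP f" "Tgt FP g' = Src FP f'" for f g f' g'
    using that
    by - (erule EA_cases[of f], erule EA_cases[of g], erule EA_cases[of f'], erule EA_cases[of g'],
      auto simp: interchange)
  ultimately show ?thesis
    by (simp add: strict_categorical_group_def is_category_FP group_EO group_EA)
qed

end

section \<open>The categorical torus\<close>

lemma circle_exp_add: "circle_exp (r + s) = circle_exp r * circle_exp s"
  by (simp add: circle_exp_def distrib_left flip: exp_add)

lemma norm_circle_exp [simp]: "cmod (circle_exp r) = 1"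
  by (simp add: circle_exp_def)

lemma circle_exp_of_int [simp]: "circle_exp (of_int j) = 1"
proof -
  have "circle_exp (of_int j) = cis (2 * pi * of_int j)"
    by (simp add: circle_exp_def cis_conv_exp mult_ac)
  then show ?thesis by (simp add: cis_multiple_2pi)
qed

lemma circle_exp_half_of_int: "circle_exp (of_int j / 2) = (-1) powi j"
proof (cases "even j")
  case True
  then obtain k where "j = 2 * k" by blast
  then show ?thesis using circle_exp_of_int[of k] by (simp add: power_int_mult)
next
  case False
  then obtain k where k: "j = 2 * k + 1" by (rule oddE)
  have "circle_exp (1 / 2) = -1" by (simp add: circle_exp_def)
  moreover have "of_int j / 2 = real_of_int k + 1 / 2" by (simp add: k)
  ultimately show ?thesis
    by (simp only: circle_exp_add circle_exp_of_int) (simp add: k power_int_add power_int_mult)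
qed

lemma nonzero_if_norm_eq_1: "cmod z = 1 \<Longrightarrow> z \<noteq> 0"
  by auto

lemma inverse_minus_one_powi [simp]: "inverse ((-1::complex) powi j) = (-1) powi j"
  by (cases "even j") simp_all

lemma minus_one_powi_cases: "(-1::complex) powi j = 1 \<or> (-1::complex) powi j = -1"
  by (cases "even j") simp_all

section \<open>A lattice with a bilinear form: halving, and the pairing with the Lie algebra\<close>

locale lattice_form = L: comm_group L
  for L :: "('l, 'x) monoid_scheme" +
  fixes J :: "'l \<Rightarrow> 'l \<Rightarrow> int"
  assumes J: "biadditive L L additive_group J"
begin

sublocale LR: comm_group_pair L "additive_group :: real monoid"
  by (simp add: comm_group_pair_def L.comm_group_axioms)

sublocale V: comm_group "lie L" by (rule LR.comm_group_tensor)

lemma J_simps [simp]: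
  "m \<in> carrier L \<Longrightarrow> m' \<in> carrier L \<Longrightarrow> n \<in> carrier L \<Longrightarrow> J (m \<otimes>\<^bsub>L\<^esub> m') n = J m n + J m' n"
  "m \<in> carrier L \<Longrightarrow> m' \<in> carrier L \<Longrightarrow> n \<in> carrier L \<Longrightarrow> J n (m \<otimes>\<^bsub>L\<^esub> m') = J n m + J n m'"
  "n \<in> carrier L \<Longrightarrow> J \<one>\<^bsub>L\<^esub> n = 0" "n \<in> carrier L \<Longrightarrow> J n \<one>\<^bsub>L\<^esub> = 0"
  "m \<in> carrier L \<Longrightarrow> n \<in> carrier L \<Longrightarrow> J (inv\<^bsub>L\<^esub> m) n = - J m n"
  "m \<in> carrier L \<Longrightarrow> n \<in> carrier L \<Longrightarrow> J m (inv\<^bsub>L\<^esub> n) = - J m n"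
  using biadditiveD(2,3)[OF J] biadditive_group[OF L.is_group L.is_group comm_group.axioms(2) J]
  by simp_all

abbreviation "incl \<equiv> lattice_incl L"

lemma incl_hom: "incl \<in> hom L (lie L)"
  by (rule homI) (simp_all add: lattice_incl_def LR.pure_tensor_mult)

sublocale incl: group_hom L "lie L" incl
  by unfold_locales (rule incl_hom)

text \<open>Scalar multiplication by 1/2. As \<open>lie L\<close> is only a group, it is obtained by
  lifting division by 2 in the real factor.\<close>

definition half :: "('l \<times> real \<Rightarrow>\<^sub>0 int) set \<Rightarrow> ('l \<times> real \<Rightarrow>\<^sub>0 int) set" where
  "half = tensor_lift L additive_group (lie L) (\<lambda>m r. pure_tensor L additive_group m (r / 2))"

lemma half_biadditive:
  "biadditive L (additive_group :: real monoid) (lie L) (\<lambda>m r. pure_tensor L additive_group m (r / 2))"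
  using LR.pure_tensor_mult(2)[of _ "_ / 2" "_ / 2"]
  by (intro biadditiveI) (simp_all add: LR.pure_tensor_mult add_divide_distrib)

sublocale half: group_hom "lie L" "lie L" half
  by unfold_locales (simp add: half_def LR.tensor_lift(1)[OF V.comm_group_axioms half_biadditive])

lemma half_pure [simp]:
  "m \<in> carrier L \<Longrightarrow> half (pure_tensor L additive_group m r) = pure_tensor L additive_group m (r / 2)"
  using LR.tensor_lift(2)[OF V.comm_group_axioms half_biadditive] by (simp add: half_def)

lemma half_twice [simp]: "x \<in> carrier (lie L) \<Longrightarrow> half x \<otimes>\<^bsub>lie L\<^esub> half x = x"
proof (induction rule: LR.tensor_induct)
  case (pure m r)
  then show ?case by (simp flip: LR.pure_tensor_mult(2))
next
  case (mult s t)
  then show ?case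
    using half.hom_closed[OF mult(1)] half.hom_closed[OF mult(2)]
    by (simp add: V.m_ac)
qed

text \<open>Halving also undoes doubling, because \<open>half\<close> is a homomorphism: half (x +
  x) = half x + half x = x. This is uniqueness of division by 2.\<close>

lemma half_eqI: "x \<in> carrier (lie L) \<Longrightarrow> x \<otimes>\<^bsub>lie L\<^esub> x = y \<Longrightarrow> x = half y"
  using half_twice[of x] half.hom_mult[of x x] by simp

text \<open>The correction factor in the product of arrows, isolated as a pairing of
  \<open>L\<close> with \<open>lie L\<close>; the laws of the torus then reduce to its
  biadditivity.\<close>

definition \<kappa> :: "'l \<Rightarrow> ('l \<times> real \<Rightarrow>\<^sub>0 int) set \<Rightarrow> complex" where
  "\<kappa> m y = circle_exp (base_change L J (incl m) y)"

lemmas base_change_real = base_change[where 'r = real, OF L.comm_group_axioms J]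

lemma kappa_norm [simp]: "cmod (\<kappa> m y) = 1"
  by (simp add: \<kappa>_def)

lemma kappa_biadditive: "biadditive L (lie L) U1 \<kappa>"
  using biadditiveD[OF base_change_real(1)]
  by (intro biadditiveI) (simp_all add: \<kappa>_def circle_exp_add)

lemma kappa_simps [simp]:
  "m \<in> carrier L \<Longrightarrow> m' \<in> carrier L \<Longrightarrow> y \<in> carrier (lie L) \<Longrightarrow> \<kappa> (m \<otimes>\<^bsub>L\<^esub> m') y = \<kappa> m y * \<kappa> m' y"
  "m \<in> carrier L \<Longrightarrow> y \<in> carrier (lie L) \<Longrightarrow> y' \<in> carrier (lie L) \<Longrightarrow> \<kappa> m (y \<otimes>\<^bsub>lie L\<^esub> y') = \<kappa> m y * \<kappa> m y'"
  "y \<in> carrier (lie L) \<Longrightarrow> \<kappa> \<one>\<^bsub>L\<^esub> y = 1" "m \<in> carrier L \<Longrightarrow> \<kappa> m \<one>\<^bsub>lie L\<^esub> = 1"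
  "m \<in> carrier L \<Longrightarrow> y \<in> carrier (lie L) \<Longrightarrow> \<kappa> (inv\<^bsub>L\<^esub> m) y = inverse (\<kappa> m y)"
  "m \<in> carrier L \<Longrightarrow> y \<in> carrier (lie L) \<Longrightarrow> \<kappa> m (inv\<^bsub>lie L\<^esub> y) = inverse (\<kappa> m y)"
  using biadditiveD(2,3)[OF kappa_biadditive]
    biadditive_group[OF L.is_group V.is_group comm_group.axioms(2) kappa_biadditive]
  by simp_all

lemma kappa_nonzero [simp]: "\<kappa> m y \<noteq> 0"
  using kappa_norm[of m y] by (metis norm_zero zero_neq_one)

text \<open>The exponent is the integer J(m, n). Interchange in the torus holds because of this: the
  two sides differ exactly by such a factor.\<close>

lemma kappa_incl [simp]: "m \<in> carrier L \<Longrightarrow> n \<in> carrier L \<Longrightarrow> \<kappa> m (incl n) = 1"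
  by (simp add: \<kappa>_def lattice_incl_def base_change_real)

lemma kappa_half [simp]: "m \<in> carrier L \<Longrightarrow> n \<in> carrier L \<Longrightarrow> \<kappa> m (half (incl n)) = (-1) powi J m n"
  by (simp add: \<kappa>_def lattice_incl_def base_change_real circle_exp_half_of_int)

abbreviation "\<T> \<equiv> categorical_torus L J"

lemma torus_simps [simp]:
  "Obj \<T> = carrier (lie L)"
  "(x, m, z) \<in> Arr \<T> \<longleftrightarrow> x \<in> carrier (lie L) \<and> m \<in> carrier L \<and> cmod z = 1"
  "Src \<T> (x, m, z) = x" "Tgt \<T> (x, m, z) = x \<otimes>\<^bsub>lie L\<^esub> incl m" "Ident \<T> x = (x, \<one>\<^bsub>L\<^esub>, 1)"
  "Comp \<T> (y, n, w) (x, m, z) = (x, m \<otimes>\<^bsub>L\<^esub> n, z * w)" "Tobj \<T> x y = x \<otimes>\<^bsub>lie L\<^esub> y"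
  "Tarr \<T> (x, m, z) (y, n, w) = (x \<otimes>\<^bsub>lie L\<^esub> y, m \<otimes>\<^bsub>L\<^esub> n, z * w * \<kappa> m y)"
  "Tunit \<T> = \<one>\<^bsub>lie L\<^esub>"
  by (simp_all add: categorical_torus_def \<kappa>_def)

lemma strict_categorical_group_torus: "strict_categorical_group \<T>"
proof -
  have O: "object_group \<T> = lie L"
    by (simp add: object_group_def categorical_torus_def)
  have A: "group (arrow_group \<T>)"
  proof (rule groupI)
    fix f assume "f \<in> carrier (arrow_group \<T>)"
    then obtain x m z where f: "f = (x, m, z)" "x \<in> carrier (lie L)" "m \<in> carrier L" "cmod z = 1"
      by (cases f) (auto simp: arrow_group_def)
    then have "z \<noteq> 0" by auto
    then show "\<exists>g\<in>carrier (arrow_group \<T>). g \<otimes>\<^bsub>arrow_group \<T>\<^esub> f = \<one>\<^bsub>arrow_group \<T>\<^esub>"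
      \<comment> \<open>The product with f contributes \<open>\<kappa> (inv m) x\<close>, which is
        the inverse of the factor \<open>\<kappa> m x\<close> placed in the label.\<close>
      using f by (intro bexI[of _ "(inv\<^bsub>lie L\<^esub> x, inv\<^bsub>L\<^esub> m, inverse z * \<kappa> m x)"])
        (auto simp: arrow_group_def norm_mult norm_divide field_simps)
  qed (auto simp: arrow_group_def norm_mult V.m_assoc L.m_assoc)
  have "is_category \<T>"
    unfolding is_category_def
    by (auto simp: norm_mult V.m_assoc L.m_assoc)
  moreover have "Src \<T> \<in> hom (arrow_group \<T>) (lie L)" "Tgt \<T> \<in> hom (arrow_group \<T>) (lie L)"
    by (rule homI; auto simp: arrow_group_def V.m_ac)+
  moreover have "Ident \<T> \<in> hom (lie L) (arrow_group \<T>)"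
    by (rule homI) (auto simp: arrow_group_def)
  moreover have "Tarr \<T> (Comp \<T> f g) (Comp \<T> f' g') = Comp \<T> (Tarr \<T> f f') (Tarr \<T> g g')"
    if "f \<in> Arr \<T>" "g \<in> Arr \<T>" "f' \<in> Arr \<T>" "g' \<in> Arr \<T>" "Tgt \<T> g = Src \<T> f" "Tgt \<T> g' = Src \<T> f'" for f g f' g'
    using that by (cases f; cases g; cases f'; cases g') (auto simp: L.m_ac)
  ultimately show ?thesis
    unfolding strict_categorical_group_def O using A V.is_group by blast
qed

abbreviation "\<rho> \<equiv> torus_inversion L"

lemma inversion_simps [simp]:
  "Fobj (\<rho> 1) x = x" "Farr (\<rho> 1) f = f" "Fobj (\<rho> (-1)) x = inv\<^bsub>lie L\<^esub> x"
  "Farr (\<rho> (-1)) (x, m, z) = (inv\<^bsub>lie L\<^esub> x, inv\<^bsub>L\<^esub> m, z)"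
  by (simp_all add: torus_inversion_def)

text \<open>Negation may keep labels unchanged because the signs in the two arguments of
  \<open>\<kappa>\<close> cancel.\<close>

lemma strict_monoidal_action_torus: "strict_monoidal_action sign_group \<T> \<rho>"
proof -
  have "strict_monoidal_functor \<T> \<T> (\<rho> 1)"
    unfolding strict_monoidal_functor_def is_functor_def by auto
  moreover have "strict_monoidal_functor \<T> \<T> (\<rho> (-1))"
    unfolding strict_monoidal_functor_def is_functor_def
    by (auto simp: V.inv_mult L.inv_mult)
  ultimately show ?thesis
    using comm_group.axioms(2)[OF comm_group_sign_group]
    unfolding strict_monoidal_action_def by auto
qed

sublocale strict_cat_group_action \<T> sign_group \<rho>
  by (simp add: strict_cat_group_action_def strict_cat_group_def strict_cat_group_action_axioms_def
      strict_categorical_group_torus strict_monoidal_action_torus)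

end

section \<open>The crossed module of the fixed points\<close>

context lattice_form
begin

lemma object_group_torus [simp]: "object_group \<T> = lie L"
  by (simp add: object_group_def categorical_torus_def)

text \<open>
  The fixed point \<open>(x, e)\<close> with \<open>x = n/2\<close> and \<open>e_{-1}\<close> the arrow from \<open>n/2\<close> to \<open>-n/2\<close> labelled by
  \<open>\<epsilon>\<close>; the cocycle condition at \<open>(-1, -1)\<close> forces \<open>\<epsilon>\<^sup>2 = 1\<close>.
\<close>

definition fixed_object :: "'l \<Rightarrow> complex
    \<Rightarrow> ('l \<times> real \<Rightarrow>\<^sub>0 int) set \<times> (complex \<Rightarrow> ('l \<times> real \<Rightarrow>\<^sub>0 int) set \<times> 'l \<times> complex)" where
  "fixed_object n \<epsilon> = (half (incl n),
     \<lambda>g \<in> carrier sign_group. if g = 1 then (half (incl n), \<one>\<^bsub>L\<^esub>, 1) else (half (incl n), inv\<^bsub>L\<^esub> n, \<epsilon>))"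

lemma half_incl_inv: "n \<in> carrier L \<Longrightarrow> half (incl n) \<otimes>\<^bsub>lie L\<^esub> inv\<^bsub>lie L\<^esub> incl n = inv\<^bsub>lie L\<^esub> half (incl n)"
  using half_twice[of "incl n"]
  by (metis V.inv_mult_group V.m_assoc V.r_inv V.r_one V.inv_closed V.l_inv V.l_one half.hom_closed incl.hom_closed)

lemma fixed_object_EO:
  assumes "n \<in> carrier L" "\<epsilon> \<in> {1, -1}"
  shows "fixed_object n \<epsilon> \<in> EO"
  unfolding fixed_object_def equivariant_objects_def
  using assms by (auto simp: half_incl_inv)

lemma EO_eq_fixed_object:
  assumes "s \<in> EO"
  obtains n \<epsilon> where "n \<in> carrier L" "\<epsilon> \<in> {1, -1}" "s = fixed_object n \<epsilon>"
proof -
  obtain x e where s: "s = (x, e)" by (cases s)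
  note e = EO_D[OF assms[unfolded s]]
  obtain m z where e1: "e 1 = (x, m, z)" "x \<in> carrier (lie L)" "m \<in> carrier L" "cmod z = 1"
    using e(3,4)[of 1] by (cases "e 1") auto
  obtain k w where e2: "e (-1) = (x, k, w)" "k \<in> carrier L" "cmod w = 1"
    using e(3,4)[of "-1"] by (cases "e (-1)") auto
  \<comment> \<open>The cocycle condition at (1, 1) makes both components of \<open>e 1\<close>
    idempotent, hence trivial in their groups.\<close>
  have "m \<otimes>\<^bsub>L\<^esub> m = m" "z * z = z"
    using e(6)[of 1 1] e1 by simp_all
  then have e1': "e 1 = (x, \<one>\<^bsub>L\<^esub>, 1)"
    using e1 L.r_cancel_one' by auto
  have w: "w * w = 1"
    using e(6)[of "-1" "-1"] e1' e2 by simp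
  have "x \<otimes>\<^bsub>lie L\<^esub> incl k = inv\<^bsub>lie L\<^esub> x"
    using e(5)[of "-1"] e2 by simp
  then have "x \<otimes>\<^bsub>lie L\<^esub> x = incl (inv\<^bsub>L\<^esub> k)"
    using e1(2) e2(2) by (metis V.inv_equality V.inv_solve_left V.m_comm V.m_closed V.inv_closed incl.hom_closed incl.hom_inv)
  then have x: "x = half (incl (inv\<^bsub>L\<^esub> k))" by (rule half_eqI[OF e1(2)])
  have "e = snd (fixed_object (inv\<^bsub>L\<^esub> k) w)"
    using e1' e2 by (intro extensionalityI[OF e(2)]) (auto simp: fixed_object_def x)
  moreover have "w \<in> {1, -1}" using w by (simp add: square_eq_1_iff)
  ultimately show thesis
    using e2(2) x by (intro that[of "inv\<^bsub>L\<^esub> k" w]) (simp_all add: s fixed_object_def)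
qed

text \<open>An inverse of \<open>fixed_object\<close> by projections instead of a choice: it reads
  the arrow at -1, whose lattice part is -n.\<close>

definition label :: "('l \<times> real \<Rightarrow>\<^sub>0 int) set \<times> (complex \<Rightarrow> ('l \<times> real \<Rightarrow>\<^sub>0 int) set \<times> 'l \<times> complex)
    \<Rightarrow> 'l \<times> complex" where
  "label s = (inv\<^bsub>L\<^esub> fst (snd (snd s (-1))), snd (snd (snd s (-1))))"

lemma label_fixed_object [simp]: "n \<in> carrier L \<Longrightarrow> label (fixed_object n \<epsilon>) = (n, \<epsilon>)"
  by (simp add: label_def fixed_object_def)

lemma fixed_object_inject:
  "n \<in> carrier L \<Longrightarrow> k \<in> carrier L \<Longrightarrow> fixed_object n \<epsilon> = fixed_object k \<delta> \<longleftrightarrow> n = k \<and> \<epsilon> = \<delta>"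
  by (metis label_fixed_object prod.inject)

lemma Tobj_fixed_object:
  assumes "n \<in> carrier L" "k \<in> carrier L"
  shows "Tobj FP (fixed_object n \<epsilon>) (fixed_object k \<delta>) = fixed_object (n \<otimes>\<^bsub>L\<^esub> k) (\<epsilon> * \<delta> * (-1) powi J n k)"
  using assms by (auto simp: fixed_object_def L.inv_mult power_int_minus_one_minus intro!: restrict_ext)

lemma Tunit_fixed_object: "Tunit FP = fixed_object \<one>\<^bsub>L\<^esub> 1"
  by (auto simp: fixed_object_def intro!: restrict_ext)

text \<open>Equivariance at -1 compares m - k with -n - m and z \<delta> with \<epsilon> z. The
  first determines the target k = n + 2m; in the second z cancels, so z stays free and \<delta> =
  \<epsilon>.\<close>

lemma EA_iff:
  "\<alpha> \<in> EA \<longleftrightarrow> (\<exists>n \<epsilon> m z. n \<in> carrier L \<and> \<epsilon> \<in> {1, -1} \<and> m \<in> carrier L \<and> cmod z = 1 \<and>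
    \<alpha> = (fixed_object n \<epsilon>, (half (incl n), m, z), fixed_object (n \<otimes>\<^bsub>L\<^esub> (m \<otimes>\<^bsub>L\<^esub> m)) \<epsilon>))"
proof
  assume "\<alpha> \<in> EA"
  then obtain x e a y f where \<alpha>: "\<alpha> = ((x, e), a, (y, f))" "((x, e), a, (y, f)) \<in> EA"
    by (rule EA_cases)
  note a = EA_D[OF \<alpha>(2)]
  obtain n \<epsilon> where n: "n \<in> carrier L" "\<epsilon> \<in> {1, -1}" "(x, e) = fixed_object n \<epsilon>"
    using a(1) by (rule EO_eq_fixed_object)
  obtain k \<delta> where k: "k \<in> carrier L" "\<delta> \<in> {1, -1}" "(y, f) = fixed_object k \<delta>"
    using a(2) by (rule EO_eq_fixed_object)
  obtain m z where m: "a = (half (incl n), m, z)" "m \<in> carrier L" "cmod z = 1"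
    using a(3,4) n(3) by (cases a) (auto simp: fixed_object_def)
  have "z \<noteq> 0" using m(3) by auto
  then have "m \<otimes>\<^bsub>L\<^esub> inv\<^bsub>L\<^esub> k = inv\<^bsub>L\<^esub> n \<otimes>\<^bsub>L\<^esub> inv\<^bsub>L\<^esub> m" "\<delta> = \<epsilon>"
    using a(6)[of "-1"] m n(3) k(3) by (auto simp: fixed_object_def)
  moreover from this have "k = n \<otimes>\<^bsub>L\<^esub> (m \<otimes>\<^bsub>L\<^esub> m)"
    using n(1) k(1) m(2)
    by (metis L.inv_closed L.inv_inv L.inv_mult L.inv_solve_right L.m_assoc L.m_closed L.m_comm)
  ultimately show "\<exists>n \<epsilon> m z. n \<in> carrier L \<and> \<epsilon> \<in> {1, -1} \<and> m \<in> carrier L \<and> cmod z = 1 \<and>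
    \<alpha> = (fixed_object n \<epsilon>, (half (incl n), m, z), fixed_object (n \<otimes>\<^bsub>L\<^esub> (m \<otimes>\<^bsub>L\<^esub> m)) \<epsilon>)"
    using n k m \<alpha>(1) by blast
next
  assume "\<exists>n \<epsilon> m z. n \<in> carrier L \<and> \<epsilon> \<in> {1, -1} \<and> m \<in> carrier L \<and> cmod z = 1 \<and>
    \<alpha> = (fixed_object n \<epsilon>, (half (incl n), m, z), fixed_object (n \<otimes>\<^bsub>L\<^esub> (m \<otimes>\<^bsub>L\<^esub> m)) \<epsilon>)"
  then obtain n \<epsilon> m z where *: "n \<in> carrier L" "\<epsilon> \<in> {1, -1}" "m \<in> carrier L" "cmod z = 1"
    "\<alpha> = (fixed_object n \<epsilon>, (half (incl n), m, z), fixed_object (n \<otimes>\<^bsub>L\<^esub> (m \<otimes>\<^bsub>L\<^esub> m)) \<epsilon>)"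
    by blast
  have "m \<otimes>\<^bsub>L\<^esub> inv\<^bsub>L\<^esub> (n \<otimes>\<^bsub>L\<^esub> (m \<otimes>\<^bsub>L\<^esub> m)) = inv\<^bsub>L\<^esub> n \<otimes>\<^bsub>L\<^esub> inv\<^bsub>L\<^esub> m"
    using * by (metis L.inv_closed L.inv_mult L.inv_solve_right L.m_assoc L.m_closed L.m_comm)
  moreover have "half (incl n) \<otimes>\<^bsub>lie L\<^esub> incl m = half (incl (n \<otimes>\<^bsub>L\<^esub> (m \<otimes>\<^bsub>L\<^esub> m)))"
    using * half_twice[of "incl m"] by simp
  ultimately show "\<alpha> \<in> EA"
    using * fixed_object_EO[of n \<epsilon>] fixed_object_EO[of "n \<otimes>\<^bsub>L\<^esub> (m \<otimes>\<^bsub>L\<^esub> m)" \<epsilon>]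
    by (auto simp: equivariant_arrows_def fixed_object_def)
qed

lemma lattice_ext_simps [simp]:
  "(n, \<epsilon>) \<in> carrier (lattice_ext L J) \<longleftrightarrow> n \<in> carrier L \<and> \<epsilon> \<in> {1, -1}"
  "(n, \<epsilon>) \<otimes>\<^bsub>lattice_ext L J\<^esub> (k, \<delta>) = (n \<otimes>\<^bsub>L\<^esub> k, \<epsilon> * \<delta> * (-1) powi J n k)"
  "\<one>\<^bsub>lattice_ext L J\<^esub> = (\<one>\<^bsub>L\<^esub>, 1)"
  by (simp_all add: lattice_ext_def sign_extension_def)

sublocale ext: group "lattice_ext L J"
  unfolding lattice_ext_def
  by (rule group_sign_extension[OF L.is_group])
    (auto intro!: biadditiveI simp: minus_one_powi_cases power_int_add)

text \<open>Doubled lattice elements meet the cocycle in even exponents only. Hence the boundary is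
  a homomorphism with central image, and that image acts trivially, as the Peiffer identity demands
  for a commutative top group.\<close>

lemma crossed_module_Sigma: "crossed_module (Sigma_xmod L J)"
proof -
  let ?act = "\<lambda>(n, \<epsilon>) (m, z). (m, z * (-1) powi J m n)"
  interpret U: comm_group U1 by (rule comm_group_U1)
  interpret T: comm_group "L \<times>\<times> U1"
    by (rule group.group_comm_groupI[OF DirProd_group[OF L.is_group U.is_group]])
      (auto simp: L.m_comm)
  have act_comp: "?act (b \<otimes>\<^bsub>lattice_ext L J\<^esub> c) t = ?act b (?act c t)"
    if "b \<in> carrier (lattice_ext L J)" "c \<in> carrier (lattice_ext L J)" "t \<in> carrier (L \<times>\<times> U1)" for b c t
    using that by (cases b; cases c; cases t) (auto simp: power_int_add)
  have act_one: "?act \<one>\<^bsub>lattice_ext L J\<^esub> t = t" if "t \<in> carrier (L \<times>\<times> U1)" for t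
    using that by auto
  have act_closed: "?act b t \<in> carrier (L \<times>\<times> U1)"
    if "b \<in> carrier (lattice_ext L J)" "t \<in> carrier (L \<times>\<times> U1)" for b t
    using that by (cases b; cases t) (auto simp: norm_mult norm_power_int)
  have act_iso: "?act b \<in> iso (L \<times>\<times> U1) (L \<times>\<times> U1)" if b: "b \<in> carrier (lattice_ext L J)" for b
  proof (rule isoI)
    show "?act b \<in> hom (L \<times>\<times> U1) (L \<times>\<times> U1)"
    proof (rule homI)
      fix s t assume "s \<in> carrier (L \<times>\<times> U1)" "t \<in> carrier (L \<times>\<times> U1)"
      then show "?act b (s \<otimes>\<^bsub>L \<times>\<times> U1\<^esub> t) = ?act b s \<otimes>\<^bsub>L \<times>\<times> U1\<^esub> ?act b t"
        using b by (cases b; cases s; cases t) (auto simp: power_int_add)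
    qed (rule act_closed[OF b])
    let ?b' = "inv\<^bsub>lattice_ext L J\<^esub> b"
    show "bij_betw (?act b) (carrier (L \<times>\<times> U1)) (carrier (L \<times>\<times> U1))"
    proof (rule bij_betw_byWitness[where f' = "?act ?b'"])
      show "\<forall>t\<in>carrier (L \<times>\<times> U1). ?act ?b' (?act b t) = t" "\<forall>t\<in>carrier (L \<times>\<times> U1). ?act b (?act ?b' t) = t"
        using act_comp[OF b ext.inv_closed[OF b]] act_comp[OF ext.inv_closed[OF b] b]
          ext.l_inv[OF b] ext.r_inv[OF b] act_one by simp_all
    qed (rule image_subsetI, erule act_closed[OF b], rule image_subsetI, erule act_closed[OF ext.inv_closed[OF b]])
  qed
  have bdry: "(\<lambda>(m, z). (m \<otimes>\<^bsub>L\<^esub> m, 1)) \<in> hom (L \<times>\<times> U1) (lattice_ext L J)"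
    by (rule homI) (auto simp: L.m_ac power_int_add)
  have equivariant: "(\<lambda>(m, z). (m \<otimes>\<^bsub>L\<^esub> m, 1)) (?act b t) =
      b \<otimes>\<^bsub>lattice_ext L J\<^esub> (\<lambda>(m, z). (m \<otimes>\<^bsub>L\<^esub> m, 1)) t \<otimes>\<^bsub>lattice_ext L J\<^esub> inv\<^bsub>lattice_ext L J\<^esub> b"
    if b: "b \<in> carrier (lattice_ext L J)" and t: "t \<in> carrier (L \<times>\<times> U1)" for b t
  proof -
    obtain n \<epsilon> m z where *: "b = (n, \<epsilon>)" "t = (m, z)" "n \<in> carrier L" "m \<in> carrier L"
      using b t by (cases b; cases t) auto
    have "b \<otimes>\<^bsub>lattice_ext L J\<^esub> (m \<otimes>\<^bsub>L\<^esub> m, 1) = (m \<otimes>\<^bsub>L\<^esub> m, 1) \<otimes>\<^bsub>lattice_ext L J\<^esub> b"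
      using * by (simp add: L.m_ac power_int_add)
    moreover have "(m \<otimes>\<^bsub>L\<^esub> m, 1) \<in> carrier (lattice_ext L J)" using * by simp
    ultimately show ?thesis
      using b by (simp add: * ext.m_assoc del: lattice_ext_simps)
  qed
  have peiffer: "?act ((\<lambda>(m, z). (m \<otimes>\<^bsub>L\<^esub> m, 1)) s) t = s \<otimes>\<^bsub>L \<times>\<times> U1\<^esub> t \<otimes>\<^bsub>L \<times>\<times> U1\<^esub> inv\<^bsub>L \<times>\<times> U1\<^esub> s"
    if s: "s \<in> carrier (L \<times>\<times> U1)" and t: "t \<in> carrier (L \<times>\<times> U1)" for s t
  proof -
    have "s \<otimes>\<^bsub>L \<times>\<times> U1\<^esub> t \<otimes>\<^bsub>L \<times>\<times> U1\<^esub> inv\<^bsub>L \<times>\<times> U1\<^esub> s = t"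
      using s t by (simp only: T.m_comm[of s t] T.m_assoc T.r_inv T.r_one T.inv_closed)
    then show ?thesis using s t by (cases s; cases t) (auto simp: power_int_add)
  qed
  show ?thesis
    unfolding crossed_module_def Sigma_xmod_def xmod.simps
    by (intro conjI ballI ext.is_group T.is_group bdry act_iso act_one act_comp equivariant peiffer)
qed

lemma label_iso: "label \<in> iso (object_group FP) (lattice_ext L J)"
proof (rule isoI)
  show "label \<in> hom (object_group FP) (lattice_ext L J)"
  proof (rule homI)
    fix s assume "s \<in> carrier (object_group FP)"
    then have "s \<in> EO" by (simp add: object_group_def)
    then show "label s \<in> carrier (lattice_ext L J)"
      by (rule EO_eq_fixed_object) auto
    fix t assume "t \<in> carrier (object_group FP)"
    then have "t \<in> EO" by (simp add: object_group_def)
    with \<open>s \<in> EO\<close> show "label (s \<otimes>\<^bsub>object_group FP\<^esub> t) = label s \<otimes>\<^bsub>lattice_ext L J\<^esub> label t"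
      by - (erule EO_eq_fixed_object[of s], erule EO_eq_fixed_object[of t],
        simp add: object_group_def Tobj_fixed_object del: fixed_points_simps(7))
  qed
  show "bij_betw label (carrier (object_group FP)) (carrier (lattice_ext L J))"
    by (rule bij_betw_byWitness[where f' = "\<lambda>(n, \<epsilon>). fixed_object n \<epsilon>"])
      (auto simp: object_group_def fixed_object_EO elim!: EO_eq_fixed_object)
qed

text \<open>By \<open>EA_iff\<close> these are all equivariant arrows out of the unit, so (m, z) are
  coordinates on the kernel of the source map.\<close>

definition fixed_arrow where
  "fixed_arrow m z = (fixed_object \<one>\<^bsub>L\<^esub> 1, (\<one>\<^bsub>lie L\<^esub>, m, z :: complex), fixed_object (m \<otimes>\<^bsub>L\<^esub> m) 1)"

lemma fixed_arrow_EA: "m \<in> carrier L \<Longrightarrow> cmod z = 1 \<Longrightarrow> fixed_arrow m z \<in> EA"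
  unfolding EA_iff fixed_arrow_def by (rule exI[of _ "\<one>\<^bsub>L\<^esub>"]) force

lemma kernel_Src_FP:
  "kernel (arrow_group FP) (object_group FP) (Src FP) = {fixed_arrow m z |m z. m \<in> carrier L \<and> cmod z = 1}"
proof (intro equalityI subsetI)
  fix \<alpha> assume "\<alpha> \<in> kernel (arrow_group FP) (object_group FP) (Src FP)"
  then have \<alpha>: "\<alpha> \<in> EA" "Src FP \<alpha> = fixed_object \<one>\<^bsub>L\<^esub> 1"
    by (simp_all add: kernel_def arrow_group_def object_group_def flip: Tunit_fixed_object del: fixed_points_simps(9))
  then obtain n \<epsilon> m z where n: "n \<in> carrier L" "m \<in> carrier L" "cmod z = 1"
    "\<alpha> = (fixed_object n \<epsilon>, (half (incl n), m, z), fixed_object (n \<otimes>\<^bsub>L\<^esub> (m \<otimes>\<^bsub>L\<^esub> m)) \<epsilon>)"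
    unfolding EA_iff by blast
  with \<alpha>(2) have "n = \<one>\<^bsub>L\<^esub>" "\<epsilon> = 1" by (simp_all add: fixed_object_inject)
  with n show "\<alpha> \<in> {fixed_arrow m z |m z. m \<in> carrier L \<and> cmod z = 1}"
    by (auto simp: fixed_arrow_def)
next
  fix \<alpha> assume "\<alpha> \<in> {fixed_arrow m z |m z. m \<in> carrier L \<and> cmod z = 1}"
  then obtain m z where m: "\<alpha> = fixed_arrow m z" "m \<in> carrier L" "cmod z = 1" by blast
  then have "\<alpha> \<in> EA" by (simp add: fixed_arrow_EA)
  then show "\<alpha> \<in> kernel (arrow_group FP) (object_group FP) (Src FP)"
    by (simp add: m fixed_arrow_def kernel_def arrow_group_def object_group_def
        flip: Tunit_fixed_object del: fixed_points_simps(9))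
qed

text \<open>Both arrows start at the origin, so the correction factor is
  \<open>\<kappa> m 0 = 1\<close>, and the sign in the target has exponent J(2m, 2n). This is why
  the top group is a plain direct product.\<close>

lemma Tarr_fixed_arrow:
  assumes "m \<in> carrier L" "n \<in> carrier L"
  shows "Tarr FP (fixed_arrow m z) (fixed_arrow n w) = fixed_arrow (m \<otimes>\<^bsub>L\<^esub> n) (z * w)"
  using assms by (simp add: fixed_arrow_def Tobj_fixed_object power_int_add L.m_ac del: fixed_points_simps(7))

sublocale FP: strict_cat_group FP
  by unfold_locales (rule strict_categorical_group_fixed_points)

text \<open>The square of \<epsilon> is 1, and tensoring with
  \<open>fixed_object n \<epsilon>\<close> contributes the sign with exponent J(-n, n), which the
  extra factor cancels.\<close>

lemma inv_fixed_object:
  assumes "n \<in> carrier L" "\<epsilon> \<in> {1, -1}"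
  shows "FP.inv_obj (fixed_object n \<epsilon>) = fixed_object (inv\<^bsub>L\<^esub> n) (\<epsilon> * (-1) powi J n n)"
proof (rule FP.O.inv_equality)
  show "fixed_object (inv\<^bsub>L\<^esub> n) (\<epsilon> * (-1) powi J n n) \<otimes>\<^bsub>object_group FP\<^esub> fixed_object n \<epsilon> = \<one>\<^bsub>object_group FP\<^esub>"
    using assms
    by (auto simp add: Tobj_fixed_object Tunit_fixed_object power_int_minus_one_minus mult_ac
        simp del: fixed_points_simps(7,9))
qed (use assms minus_one_powi_cases[of "J n n"] in \<open>auto intro!: fixed_object_EO\<close>)

text \<open>Only the underlying arrow is computed, since the isomorphism \<open>\<phi>\<close> below
  reads off nothing but its lattice part and label; the endpoints need not be normalised.\<close>

lemma conjugate_fixed_arrow: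
  assumes "n \<in> carrier L" "\<epsilon> \<in> {1, -1}" "m \<in> carrier L"
  shows "fst (snd (Tarr FP (Tarr FP (Ident FP (fixed_object n \<epsilon>)) (fixed_arrow m z))
    (FP.inv_arr (Ident FP (fixed_object n \<epsilon>))))) = (\<one>\<^bsub>lie L\<^esub>, m, z * (-1) powi J m n)"
proof -
  have Ident: "Ident FP (fixed_object k \<delta>) = (fixed_object k \<delta>, (half (incl k), \<one>\<^bsub>L\<^esub>, 1), fixed_object k \<delta>)" for k \<delta>
    by (simp add: fixed_object_def)
  have "FP.inv_arr (Ident FP (fixed_object n \<epsilon>)) = Ident FP (FP.inv_obj (fixed_object n \<epsilon>))"
    using FP.ident.hom_inv[of "fixed_object n \<epsilon>"] assms fixed_object_EO[of n \<epsilon>] by (simp del: fixed_points_simps(5))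
  then show ?thesis
    using assms by (simp add: inv_fixed_object Ident fixed_arrow_def power_int_minus_one_minus del: fixed_points_simps(5,7))
qed

lemma crossed_module_fixed_points:
  "crossed_module_isomorphic (crossed_module_of FP) (Sigma_xmod L J)"
proof -
  define \<phi> where "\<phi> \<alpha> = snd (fst (snd \<alpha>))"
    for \<alpha> :: "(('l \<times> real \<Rightarrow>\<^sub>0 int) set \<times> (complex \<Rightarrow> ('l \<times> real \<Rightarrow>\<^sub>0 int) set \<times> 'l \<times> complex)) \<times>
      (('l \<times> real \<Rightarrow>\<^sub>0 int) set \<times> 'l \<times> complex) \<times>
      (('l \<times> real \<Rightarrow>\<^sub>0 int) set \<times> (complex \<Rightarrow> ('l \<times> real \<Rightarrow>\<^sub>0 int) set \<times> 'l \<times> complex))"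
  have \<phi> [simp]: "\<phi> (fixed_arrow m z) = (m, z)" for m z
    by (simp add: \<phi>_def fixed_arrow_def)
  let ?T = "Top (crossed_module_of FP)"
  have T: "carrier ?T = {fixed_arrow m z |m z. m \<in> carrier L \<and> cmod z = 1}"
    "\<alpha> \<otimes>\<^bsub>?T\<^esub> \<beta> = Tarr FP \<alpha> \<beta>" for \<alpha> \<beta>
    by (simp_all add: crossed_module_of_def kernel_Src_FP)
  have \<phi>_iso: "\<phi> \<in> iso ?T (L \<times>\<times> U1)"
  proof (rule isoI)
    show "\<phi> \<in> hom ?T (L \<times>\<times> U1)"
      by (rule homI) (auto simp: T Tarr_fixed_arrow)
    show "bij_betw \<phi> (carrier ?T) (carrier (L \<times>\<times> U1))"
      by (rule bij_betw_byWitness[where f' = "\<lambda>(m, z). fixed_arrow m z"]) (auto simp: T, blast)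
  qed
  have boundary: "Boundary (Sigma_xmod L J) (\<phi> t) = label (Boundary (crossed_module_of FP) t)" if t: "t \<in> carrier ?T" for t
  proof -
    obtain m z where m: "m \<in> carrier L" "t = fixed_arrow m z"
      using t by (auto simp: T)
    then have "Tgt FP t = fixed_object (m \<otimes>\<^bsub>L\<^esub> m) 1" by (simp add: fixed_arrow_def)
    then show ?thesis using m by (simp add: Sigma_xmod_def crossed_module_of_def)
  qed
  have act: "\<phi> (Act (crossed_module_of FP) b t) = Act (Sigma_xmod L J) (label b) (\<phi> t)"
    if b: "b \<in> carrier (Base (crossed_module_of FP))" and t: "t \<in> carrier ?T" for b t
  proof -
    obtain n \<epsilon> where n: "n \<in> carrier L" "\<epsilon> \<in> {1, -1}" "b = fixed_object n \<epsilon>"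
      using b by (auto simp: crossed_module_of_def elim!: EO_eq_fixed_object[of b])
    obtain m z where m: "m \<in> carrier L" "t = fixed_arrow m z"
      using t by (auto simp: T)
    show ?thesis
      using arg_cong[OF conjugate_fixed_arrow[OF n(1,2) m(1), of z], of snd, folded \<phi>_def] n m
      by (simp add: crossed_module_of_def Sigma_xmod_def)
  qed
  have "\<phi> \<in> iso ?T (Top (Sigma_xmod L J))" "label \<in> iso (Base (crossed_module_of FP)) (Base (Sigma_xmod L J))"
    using \<phi>_iso label_iso by (simp_all add: Sigma_xmod_def crossed_module_of_def)
  then show ?thesis
    unfolding crossed_module_isomorphic_def
    using FP.crossed_module_of crossed_module_Sigma boundary act by blast
qed

end

section \<open>Points of order two and the central extension\<close>

lemma bit_sign_add: "bit_sign (b + c) = bit_sign b * bit_sign c"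
  by (cases b; cases c) (simp_all add: bit_sign_def)

lemma of_int_bit_eq_0_iff: "(of_int j :: bit) = 0 \<longleftrightarrow> even j"
proof (cases "even j")
  case True
  then show ?thesis by (auto simp: bit_2_eq_0 elim!: evenE)
next
  case False
  then show ?thesis by (auto simp: bit_2_eq_0 elim!: oddE)
qed

text \<open>Reconciles two forms of the cocycle: the form reduced modulo 2 and read as a sign, and
  the power of -1 used over \<open>L\<close>.\<close>

lemma bit_sign_of_int: "bit_sign (of_int j) = (-1) powi j"
  by (cases "even j") (simp_all add: bit_sign_def of_int_bit_eq_0_iff)

section \<open>Coordinates on the free lattice\<close>

locale free_lattice_form = lattice_form L J
  for L :: "('l, 'x) monoid_scheme" and J :: "'l \<Rightarrow> 'l \<Rightarrow> int" +
  assumes free: "free_of_finite_rank L"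
begin

abbreviation "\<Phi> \<equiv> free_Abelian_group :: nat set \<Rightarrow> (nat \<Rightarrow>\<^sub>0 int) monoid"

definition rank :: nat where "rank = (SOME r. L \<cong> \<Phi> {..<r})"
definition coords :: "'l \<Rightarrow> nat \<Rightarrow>\<^sub>0 int" where "coords = (SOME f. f \<in> iso L (\<Phi> {..<rank}))"

lemma coords_iso: "coords \<in> iso L (\<Phi> {..<rank})"
proof -
  have "L \<cong> \<Phi> {..<rank}"
    using free unfolding free_of_finite_rank_def rank_def by (auto intro: someI_ex)
  then show ?thesis unfolding coords_def is_iso_def some_in_eq .
qed

lemma coords_hom: "coords \<in> hom L (\<Phi> {..<rank})" and coords_bij: "bij_betw coords (carrier L) (carrier (\<Phi> {..<rank}))"
  using coords_iso by (simp_all add: iso_def)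

lemma coords_mult [simp]: "m \<in> carrier L \<Longrightarrow> n \<in> carrier L \<Longrightarrow> coords (m \<otimes>\<^bsub>L\<^esub> n) = coords m + coords n"
  using hom_mult[OF coords_hom] by simp

lemma coords_one [simp]: "coords \<one>\<^bsub>L\<^esub> = 0"
  using hom_one[OF coords_hom L.is_group group_free_Abelian_group] by simp

lemma coords_inject: "m \<in> carrier L \<Longrightarrow> n \<in> carrier L \<Longrightarrow> coords m = coords n \<longleftrightarrow> m = n"
  using coords_bij by (auto simp: bij_betw_def inj_on_def)

lemma coords_surj:
  assumes "Poly_Mapping.keys c \<subseteq> {..<rank}" obtains m where "m \<in> carrier L" "coords m = c"
  using assms coords_bij by (metis bij_betw_def carrier_free_Abelian_group_iff image_iff)

text \<open>Will show that an endomorphism of the unit, whose lattice part satisfies 2m = 0, has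
  trivial lattice part.\<close>

lemma torsion_free:
  assumes "m \<in> carrier L" "m \<otimes>\<^bsub>L\<^esub> m = \<one>\<^bsub>L\<^esub>"
  shows "m = \<one>\<^bsub>L\<^esub>"
proof -
  have "coords m + coords m = 0" using assms coords_mult[of m m] by simp
  then have "Poly_Mapping.lookup (coords m + coords m) i = 0" for i by (simp only: lookup_zero)
  then have "coords m = 0"
    by (intro poly_mapping_eqI) (simp only: lookup_add lookup_zero double_zero)
  then show ?thesis using assms(1) coords_inject[of m "\<one>\<^bsub>L\<^esub>"] by simp
qed

text \<open>Halving each coordinate gives the witness. This is how membership in 2L will be
  recognised from characters.\<close>

lemma square_if_coords_even:
  assumes m: "m \<in> carrier L" and ev: "\<And>i. even (Poly_Mapping.lookup (coords m) i)"
  obtains k where "k \<in> carrier L" "m = k \<otimes>\<^bsub>L\<^esub> k"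
proof -
  let ?c = "Poly_Mapping.map (\<lambda>j. j div 2) (coords m)"
  have lookup: "Poly_Mapping.lookup ?c i = Poly_Mapping.lookup (coords m) i div 2" for i
    by (simp add: Poly_Mapping.map.rep_eq when_def)
  have "Poly_Mapping.keys (coords m) \<subseteq> {..<rank}"
    using hom_in_carrier[OF coords_hom m] by simp
  then have "Poly_Mapping.keys ?c \<subseteq> {..<rank}"
    by (auto simp: lookup in_keys_iff subset_iff)
  then obtain k where k: "k \<in> carrier L" "coords k = ?c" by (rule coords_surj)
  have "coords m = ?c + ?c"
  proof (rule poly_mapping_eqI)
    fix i show "Poly_Mapping.lookup (coords m) i = Poly_Mapping.lookup (?c + ?c) i"
      using ev[of i] unfolding lookup_add lookup by presburger
  qed
  also have "\<dots> = coords (k \<otimes>\<^bsub>L\<^esub> k)" by (simp only: coords_mult k)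
  finally have "m = k \<otimes>\<^bsub>L\<^esub> k" using k(1) m coords_inject by blast
  with k(1) show thesis by (rule that)
qed

definition basis :: "nat \<Rightarrow> 'l" where "basis i = inv_into (carrier L) coords (frag_of i)"

lemma basis:
  assumes "i < rank" shows "basis i \<in> carrier L" "coords (basis i) = frag_of i"
proof -
  have "frag_of i \<in> coords ` carrier L"
    using assms coords_bij by (simp add: bij_betw_def)
  then show "basis i \<in> carrier L" "coords (basis i) = frag_of i"
    unfolding basis_def by (rule inv_into_into, rule f_inv_into_f)
qed

section \<open>Coordinate characters of L \<otimes> U(1), and its points of order two\<close>

sublocale LU: comm_group_pair L U1
  by (simp add: comm_group_pair_def L.comm_group_axioms)

sublocale T: comm_group "tensor L U1" by (rule LU.comm_group_tensor)

sublocale LB: comm_group_pair L "additive_group :: bit monoid"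
  by (simp add: comm_group_pair_def L.comm_group_axioms)

sublocale B: comm_group "tensor L (additive_group :: bit monoid)" by (rule LB.comm_group_tensor)

text \<open>The i-th coordinate under the identification of L \<otimes> U(1) with a power of U(1),
  namely the character m \<otimes> z \<mapsto> z to the power of the i-th coordinate of m.\<close>

definition \<chi> :: "nat \<Rightarrow> ('l \<times> complex \<Rightarrow>\<^sub>0 int) set \<Rightarrow> complex" where
  "\<chi> i = tensor_lift L U1 U1 (\<lambda>m z. z powi Poly_Mapping.lookup (coords m) i)"

lemma chi_biadditive: "biadditive L U1 U1 (\<lambda>m z. z powi Poly_Mapping.lookup (coords m) i)"
  by (rule biadditiveI)
    (auto simp: norm_power_int lookup_add power_int_add power_int_mult_distrib nonzero_if_norm_eq_1)

lemma chi_hom: "\<chi> i \<in> hom (tensor L U1) U1"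
  unfolding \<chi>_def by (rule LU.tensor_lift(1)[OF comm_group_U1 chi_biadditive])

lemma chi_pure [simp]:
  "m \<in> carrier L \<Longrightarrow> cmod z = 1 \<Longrightarrow> \<chi> i (pure_tensor L U1 m z) = z powi Poly_Mapping.lookup (coords m) i"
  unfolding \<chi>_def using LU.tensor_lift(2)[OF comm_group_U1 chi_biadditive] by simp

lemma chi_norm [simp]: "t \<in> carrier (tensor L U1) \<Longrightarrow> cmod (\<chi> i t) = 1"
  using hom_in_carrier[OF chi_hom] by simp

text \<open>For fixed z both sides are additive in the coordinate vector of m. The product
  \<open>P c\<close> is defined for arbitrary vectors c so that induction on the free Abelian group
  can run.\<close>

lemma pure_tensor_expansion:
  assumes m: "m \<in> carrier L" and z: "cmod z = 1"
  shows "pure_tensor L U1 m z =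
    finprod (tensor L U1) (\<lambda>i. pure_tensor L U1 (basis i) (z powi Poly_Mapping.lookup (coords m) i)) {..<rank}"
proof -
  define P where "P c = finprod (tensor L U1)
    (\<lambda>i. pure_tensor L U1 (basis i) (z powi Poly_Mapping.lookup c i)) {..<rank}" for c
  have z0: "z \<noteq> 0" using z by auto
  have closed: "pure_tensor L U1 (basis i) (z powi j) \<in> carrier (tensor L U1)" if "i < rank" for i j
    using that by (simp add: basis z norm_power_int)
  have P_add: "P (c + d) = P c \<otimes>\<^bsub>tensor L U1\<^esub> P d" for c d
  proof -
    have "P (c + d) = finprod (tensor L U1)
      (\<lambda>i. pure_tensor L U1 (basis i) (z powi Poly_Mapping.lookup c i) \<otimes>\<^bsub>tensor L U1\<^esub>
        pure_tensor L U1 (basis i) (z powi Poly_Mapping.lookup d i)) {..<rank}"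
      unfolding P_def
    proof (rule T.finprod_cong')
      fix i assume "i \<in> {..<rank}"
      then show "pure_tensor L U1 (basis i) (z powi Poly_Mapping.lookup (c + d) i) =
          pure_tensor L U1 (basis i) (z powi Poly_Mapping.lookup c i) \<otimes>\<^bsub>tensor L U1\<^esub>
          pure_tensor L U1 (basis i) (z powi Poly_Mapping.lookup d i)"
        using LU.pure_tensor_mult(2)[of "basis i" "z powi Poly_Mapping.lookup c i" "z powi Poly_Mapping.lookup d i"]
        by (simp add: basis z z0 norm_power_int lookup_add power_int_add)
    qed (auto intro!: T.m_closed closed)
    also have "\<dots> = P c \<otimes>\<^bsub>tensor L U1\<^esub> P d"
      unfolding P_def by (rule T.finprod_multf) (auto intro!: closed)
    finally show ?thesis .
  qed
  have P_closed: "P c \<in> carrier (tensor L U1)" for c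
    unfolding P_def by (rule T.finprod_closed) (auto intro!: closed)
  have "\<forall>m \<in> carrier L. coords m = c \<longrightarrow> pure_tensor L U1 m z = P c"
    if "Poly_Mapping.keys c \<subseteq> {..<rank}" for c
    using that
  proof (rule free_Abelian_group_induct)
    have "P 0 = \<one>\<^bsub>tensor L U1\<^esub>"
      unfolding P_def using LU.pure_tensor_group(2) by (intro T.finprod_one_eqI) (simp add: basis)
    then show "\<forall>m \<in> carrier L. coords m = 0 \<longrightarrow> pure_tensor L U1 m z = P 0"
      using coords_inject[of _ "\<one>\<^bsub>L\<^esub>"] LU.pure_tensor_group(1)[of z] z by auto
  next
    fix x y assume keys: "Poly_Mapping.keys x \<subseteq> {..<rank}" "Poly_Mapping.keys y \<subseteq> {..<rank}"
      and IH: "\<forall>m \<in> carrier L. coords m = x \<longrightarrow> pure_tensor L U1 m z = P x"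
        "\<forall>m \<in> carrier L. coords m = y \<longrightarrow> pure_tensor L U1 m z = P y"
    show "\<forall>m \<in> carrier L. coords m = x - y \<longrightarrow> pure_tensor L U1 m z = P (x - y)"
    proof (intro ballI impI)
      fix m assume m: "m \<in> carrier L" "coords m = x - y"
      obtain n where n: "n \<in> carrier L" "coords n = y" using keys(2) by (rule coords_surj)
      \<comment> \<open>The subtracted vector y is added back, so both hypotheses apply, and
        \<open>P y\<close> is cancelled at the end.\<close>
      have "pure_tensor L U1 m z \<otimes>\<^bsub>tensor L U1\<^esub> P y = pure_tensor L U1 (m \<otimes>\<^bsub>L\<^esub> n) z"
        using m n z IH(2) by (simp add: LU.pure_tensor_mult)
      also have "\<dots> = P (x - y + y)" using m n IH(1) by simp
      also have "\<dots> = P (x - y) \<otimes>\<^bsub>tensor L U1\<^esub> P y" by (rule P_add)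
      finally show "pure_tensor L U1 m z = P (x - y)"
        using m z P_closed T.right_cancel by simp
    qed
  next
    fix a assume a: "a \<in> {..<rank}"
    have "P (frag_of a) = finprod (tensor L U1) (\<lambda>i. if a = i then pure_tensor L U1 (basis i) z else \<one>\<^bsub>tensor L U1\<^esub>) {..<rank}"
      unfolding P_def
      by (rule T.finprod_cong') (use z LU.pure_tensor_group(2) in \<open>auto simp: basis\<close>)
    also have "\<dots> = pure_tensor L U1 (basis a) z"
      using a z by (intro T.finprod_singleton) (auto simp: basis)
    finally show "\<forall>m \<in> carrier L. coords m = frag_of a \<longrightarrow> pure_tensor L U1 m z = P (frag_of a)"
      using a basis[of a] by (metis coords_inject lessThan_iff)
  qed
  then show ?thesis
    using m hom_in_carrier[OF coords_hom m] by (simp add: P_def)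
qed

text \<open>Both sides are multiplicative in t, and pure tensors are the previous lemma. In
  particular the characters together determine t.\<close>

lemma tensor_expansion:
  assumes "t \<in> carrier (tensor L U1)"
  shows "t = finprod (tensor L U1) (\<lambda>i. pure_tensor L U1 (basis i) (\<chi> i t)) {..<rank}"
  using assms
proof (induction rule: LU.tensor_induct)
  case (pure m z)
  then show ?case by (simp flip: pure_tensor_expansion)
next
  case (mult s t)
  have "finprod (tensor L U1) (\<lambda>i. pure_tensor L U1 (basis i) (\<chi> i (s \<otimes>\<^bsub>tensor L U1\<^esub> t))) {..<rank} =
    finprod (tensor L U1) (\<lambda>i. pure_tensor L U1 (basis i) (\<chi> i s) \<otimes>\<^bsub>tensor L U1\<^esub> pure_tensor L U1 (basis i) (\<chi> i t)) {..<rank}"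
  proof (rule T.finprod_cong')
    fix i assume "i \<in> {..<rank}"
    then show "pure_tensor L U1 (basis i) (\<chi> i (s \<otimes>\<^bsub>tensor L U1\<^esub> t)) =
        pure_tensor L U1 (basis i) (\<chi> i s) \<otimes>\<^bsub>tensor L U1\<^esub> pure_tensor L U1 (basis i) (\<chi> i t)"
      using mult hom_mult[OF chi_hom, of s t i] LU.pure_tensor_mult(2)[of "basis i" "\<chi> i s" "\<chi> i t"]
      by (simp add: basis)
  qed (use mult in \<open>auto simp: basis\<close>)
  also have "\<dots> = s \<otimes>\<^bsub>tensor L U1\<^esub> t"
    using mult by (subst T.finprod_multf) (auto simp: basis)
  finally show ?case ..
qed

text \<open>Every character takes the value 1 or -1 on t, so each factor of the expansion is a pure
  tensor with second entry -1, and additivity in the first entry merges them.\<close>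

lemma two_torsion_pure:
  assumes t: "t \<in> carrier (tensor L U1)" "t \<otimes>\<^bsub>tensor L U1\<^esub> t = \<one>\<^bsub>tensor L U1\<^esub>"
  obtains m where "m \<in> carrier L" "t = pure_tensor L U1 m (-1)"
proof -
  have chi: "\<chi> i t = 1 \<or> \<chi> i t = -1" for i
  proof -
    have "\<chi> i t * \<chi> i t = 1"
      using hom_mult[OF chi_hom t(1) t(1), of i] t(2)
        hom_one[OF chi_hom T.is_group comm_group.axioms(2)[OF comm_group_U1], of i] by simp
    then show ?thesis by (simp add: square_eq_1_iff)
  qed
  have "\<exists>m \<in> carrier L. finprod (tensor L U1) (\<lambda>i. pure_tensor L U1 (basis i) (\<chi> i t)) {..<r} =
      pure_tensor L U1 m (-1)" if "r \<le> rank" for r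
    using that
  proof (induction r)
    case 0
    then show ?case using LU.pure_tensor_group(1)[of "-1"] by (intro bexI[of _ "\<one>\<^bsub>L\<^esub>"]) simp_all
  next
    case (Suc r)
    then obtain m where m: "m \<in> carrier L"
      "finprod (tensor L U1) (\<lambda>i. pure_tensor L U1 (basis i) (\<chi> i t)) {..<r} = pure_tensor L U1 m (-1)"
      by auto
    \<comment> \<open>Thus m accumulates the basis vectors at which the character is -1; at the
      others the zero vector keeps the second entry equal to -1.\<close>
    define b where "b = (if \<chi> r t = 1 then \<one>\<^bsub>L\<^esub> else basis r)"
    have b: "b \<in> carrier L" using Suc.prems by (simp add: b_def basis)
    have "pure_tensor L U1 (basis r) (\<chi> r t) = pure_tensor L U1 b (-1)"
      using chi[of r] LU.pure_tensor_group(1)[of "-1"] LU.pure_tensor_group(2)[of "basis r"] Suc.prems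
      by (auto simp: b_def basis)
    moreover have "finprod (tensor L U1) (\<lambda>i. pure_tensor L U1 (basis i) (\<chi> i t)) {..<Suc r} =
        pure_tensor L U1 (basis r) (\<chi> r t) \<otimes>\<^bsub>tensor L U1\<^esub>
        finprod (tensor L U1) (\<lambda>i. pure_tensor L U1 (basis i) (\<chi> i t)) {..<r}"
      unfolding lessThan_Suc using Suc.prems t(1) by (intro T.finprod_insert) (auto simp: basis)
    ultimately show ?case
      using b m by (intro bexI[of _ "b \<otimes>\<^bsub>L\<^esub> m"]) (simp_all add: LU.pure_tensor_mult)
  qed
  from this[OF order_refl] obtain m where m: "m \<in> carrier L"
    "finprod (tensor L U1) (\<lambda>i. pure_tensor L U1 (basis i) (\<chi> i t)) {..<rank} = pure_tensor L U1 m (-1)"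
    by (rule bexE)
  show thesis
    by (rule that[OF m(1) trans[OF tensor_expansion[OF t(1)] m(2)]])
qed

text \<open>If the tensor is trivial, the characters force every coordinate of m to be even.
  Conversely, a factor 2 moves across the tensor sign and squares -1.\<close>

lemma pure_minus_one_eq_one_iff:
  assumes m: "m \<in> carrier L"
  shows "pure_tensor L U1 m (-1) = \<one>\<^bsub>tensor L U1\<^esub> \<longleftrightarrow> (\<exists>k \<in> carrier L. m = k \<otimes>\<^bsub>L\<^esub> k)"
proof
  assume eq: "pure_tensor L U1 m (-1) = \<one>\<^bsub>tensor L U1\<^esub>"
  have "(-1::complex) powi Poly_Mapping.lookup (coords m) i = 1" for i
    using chi_pure[OF m, of "-1" i] eq
      hom_one[OF chi_hom T.is_group comm_group.axioms(2)[OF comm_group_U1], of i] by simp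
  then have "even (Poly_Mapping.lookup (coords m) i)" for i
    by (metis power_int_minus_left_odd power_int_1_left one_neq_neg_one)
  then show "\<exists>k \<in> carrier L. m = k \<otimes>\<^bsub>L\<^esub> k"
    using square_if_coords_even[OF m] by metis
next
  assume "\<exists>k \<in> carrier L. m = k \<otimes>\<^bsub>L\<^esub> k"
  then obtain k where k: "k \<in> carrier L" "m = k \<otimes>\<^bsub>L\<^esub> k" by blast
  have "pure_tensor L U1 m (-1) = pure_tensor L U1 k ((-1) * (-1))"
    using k LU.pure_tensor_mult(2)[of k "-1" "-1"] by (simp add: LU.pure_tensor_mult(1))
  then show "pure_tensor L U1 m (-1) = \<one>\<^bsub>tensor L U1\<^esub>"
    using k LU.pure_tensor_group(2)[of k] by simp
qed

abbreviation "Q \<equiv> two_torsion (tensor L U1)"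

lemma two_torsion_carrier: "carrier Q = {pure_tensor L U1 m (-1) |m. m \<in> carrier L}"
proof -
  have "pure_tensor L U1 m (-1) \<otimes>\<^bsub>tensor L U1\<^esub> pure_tensor L U1 m (-1) = \<one>\<^bsub>tensor L U1\<^esub>" if "m \<in> carrier L" for m
    using that LU.pure_tensor_mult(1)[of m m "-1"] pure_minus_one_eq_one_iff[of "m \<otimes>\<^bsub>L\<^esub> m"] by auto
  then show ?thesis
    by (auto simp: two_torsion_def elim!: two_torsion_pure)
qed

lemma two_torsion_simps [simp]: "v \<otimes>\<^bsub>Q\<^esub> w = v \<otimes>\<^bsub>tensor L U1\<^esub> w" "\<one>\<^bsub>Q\<^esub> = \<one>\<^bsub>tensor L U1\<^esub>"
  by (simp_all add: two_torsion_def)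

lemma group_two_torsion: "group Q"
proof -
  have "subgroup (carrier Q) (tensor L U1)"
  proof (rule T.subgroupI)
    show "carrier Q \<noteq> {}" using two_torsion_carrier by auto
  next
    fix v w assume "v \<in> carrier Q" "w \<in> carrier Q"
    then show "v \<otimes>\<^bsub>tensor L U1\<^esub> w \<in> carrier Q"
      by (auto simp: two_torsion_def T.m_ac)
  next
    fix v assume "v \<in> carrier Q"
    then show "inv\<^bsub>tensor L U1\<^esub> v \<in> carrier Q"
      by (auto simp: two_torsion_def simp flip: T.inv_mult)
  qed (auto simp: two_torsion_def)
  from T.subgroup_imp_group[OF this] show ?thesis by (simp add: two_torsion_def)
qed

section \<open>Reduction modulo 2 and the cocycle on points of order two\<close>

lemma mod2_biadditive:
  "biadditive L additive_group (tensor L U1) (\<lambda>m b. pure_tensor L U1 m (bit_sign b))"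
proof -
  have norm: "cmod (bit_sign b) = 1" for b by (simp add: bit_sign_def)
  show ?thesis
  proof (rule biadditiveI)
    fix m b b' assume "m \<in> carrier L"
    then show "pure_tensor L U1 m (bit_sign (b \<otimes>\<^bsub>additive_group\<^esub> b')) =
        pure_tensor L U1 m (bit_sign b) \<otimes>\<^bsub>tensor L U1\<^esub> pure_tensor L U1 m (bit_sign b')"
      using LU.pure_tensor_mult(2)[of m "bit_sign b" "bit_sign b'"] norm
      by (simp only: additive_group_simps bit_sign_add U1_simps)
  qed (simp_all add: norm LU.pure_tensor_mult(1))
qed

lemma mod2_pure: "m \<in> carrier L \<Longrightarrow> mod2_to_torus L (pure_tensor L additive_group m b) = pure_tensor L U1 m (bit_sign b)"
  unfolding mod2_to_torus_def using LB.tensor_lift(2)[OF T.comm_group_axioms mod2_biadditive] by simp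

text \<open>The only scalars are 0 and 1, and m \<otimes> 0 equals 0 \<otimes> 1; tensors with
  second entry 1 are closed under addition.\<close>

lemma mod2_eq_pure_one:
  assumes "t \<in> carrier (tensor L (additive_group :: bit monoid))"
  obtains m where "m \<in> carrier L" "t = pure_tensor L additive_group m 1"
proof -
  have "\<exists>m \<in> carrier L. t = pure_tensor L additive_group m 1"
    using assms
  proof (induction rule: LB.tensor_induct)
    case (pure m b)
    then show ?case
      using LB.pure_tensor_group(1)[of 1] LB.pure_tensor_group(2)[of m] by (cases b) force+
  next
    case (mult s t)
    then show ?case by (metis L.m_closed LB.pure_tensor_mult(1) UNIV_I additive_group_simps(1))
  qed
  then show thesis using that by blast
qed

text \<open>Equal images put m - n into 2L, and doubled elements vanish in L \<otimes> F_2.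
  Injectivity turns the \<open>inv_into\<close> behind \<open>torus_to_mod2\<close> into a
  computable inverse on the image.\<close>

lemma inj_on_mod2: "inj_on (mod2_to_torus L) (carrier (tensor L additive_group))"
proof (rule inj_onI)
  fix s t :: "('l \<times> bit \<Rightarrow>\<^sub>0 int) set"
  assume s: "s \<in> carrier (tensor L additive_group)" and t: "t \<in> carrier (tensor L additive_group)"
    and eq: "mod2_to_torus L s = mod2_to_torus L t"
  obtain m where m: "m \<in> carrier L" "s = pure_tensor L additive_group m 1" using s by (rule mod2_eq_pure_one)
  obtain n where n: "n \<in> carrier L" "t = pure_tensor L additive_group n 1" using t by (rule mod2_eq_pure_one)
  have "pure_tensor L U1 m (-1) = pure_tensor L U1 n (-1)"
    using eq m n by (simp add: mod2_pure bit_sign_def)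
  then have "pure_tensor L U1 (m \<otimes>\<^bsub>L\<^esub> inv\<^bsub>L\<^esub> n) (-1) = \<one>\<^bsub>tensor L U1\<^esub>"
    using m n by (simp add: LU.pure_tensor_mult LU.pure_tensor_group)
  then obtain k where k: "k \<in> carrier L" "m \<otimes>\<^bsub>L\<^esub> inv\<^bsub>L\<^esub> n = k \<otimes>\<^bsub>L\<^esub> k"
    using pure_minus_one_eq_one_iff[of "m \<otimes>\<^bsub>L\<^esub> inv\<^bsub>L\<^esub> n"] m n by auto
  then have "m = k \<otimes>\<^bsub>L\<^esub> k \<otimes>\<^bsub>L\<^esub> n" using m n by (metis L.inv_solve_right L.m_closed)
  moreover have "pure_tensor L (additive_group :: bit monoid) (k \<otimes>\<^bsub>L\<^esub> k) 1 = \<one>\<^bsub>tensor L additive_group\<^esub>"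
    using k LB.pure_tensor_mult(2)[of k 1 1] LB.pure_tensor_group(2)[of k] by (simp add: LB.pure_tensor_mult(1) bit_2_eq_0)
  ultimately show "s = t" using m n k by (simp add: LB.pure_tensor_mult(1))
qed

lemma torus_to_mod2_pure [simp]:
  "m \<in> carrier L \<Longrightarrow> torus_to_mod2 L (pure_tensor L U1 m (-1)) = pure_tensor L additive_group m 1"
  unfolding torus_to_mod2_def
  using inv_into_f_f[OF inj_on_mod2, of "pure_tensor L additive_group m 1"]
  by (simp add: mod2_pure bit_sign_def)

lemmas base_change_bit = base_change[where 'r = bit, OF L.comm_group_axioms J]

definition cocycle where
  "cocycle v w = bit_sign (base_change L J (torus_to_mod2 L v) (torus_to_mod2 L w))"

text \<open>The cocycle on points of order two pulls back to the cocycle of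
  \<open>lattice_ext\<close> along n \<mapsto> n \<otimes> (-1); hence the projection below is
  multiplicative.\<close>

lemma cocycle_pure [simp]:
  "m \<in> carrier L \<Longrightarrow> n \<in> carrier L \<Longrightarrow>
    cocycle (pure_tensor L U1 m (-1)) (pure_tensor L U1 n (-1)) = (-1) powi J m n"
  by (simp only: cocycle_def torus_to_mod2_pure base_change_bit mult_1_right bit_sign_of_int)

lemma two_torsion_ext_eq: "two_torsion_ext L J = sign_extension Q cocycle"
  unfolding two_torsion_ext_def cocycle_def[abs_def] ..

lemma group_two_torsion_ext: "group (two_torsion_ext L J)"
  unfolding two_torsion_ext_eq
proof (rule group_sign_extension[OF group_two_torsion biadditiveI])
  fix u v assume "u \<in> carrier Q" "v \<in> carrier Q"
  then obtain m n where "m \<in> carrier L" "n \<in> carrier L"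
    "u = pure_tensor L U1 m (-1)" "v = pure_tensor L U1 n (-1)"
    unfolding two_torsion_carrier by blast
  then show "cocycle u v \<in> carrier sign_group"
    using minus_one_powi_cases[of "J m n"] by simp
next
  fix u v w assume "u \<in> carrier Q" "v \<in> carrier Q" "w \<in> carrier Q"
  then obtain m n k where "m \<in> carrier L" "n \<in> carrier L" "k \<in> carrier L"
    and uvw: "u = pure_tensor L U1 m (-1)" "v = pure_tensor L U1 n (-1)" "w = pure_tensor L U1 k (-1)"
    unfolding two_torsion_carrier by blast
  moreover from this have "u \<otimes>\<^bsub>Q\<^esub> v = pure_tensor L U1 (m \<otimes>\<^bsub>L\<^esub> n) (-1)"
    and "v \<otimes>\<^bsub>Q\<^esub> w = pure_tensor L U1 (n \<otimes>\<^bsub>L\<^esub> k) (-1)"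
    by (simp_all add: LU.pure_tensor_mult(1))
  ultimately show "cocycle (u \<otimes>\<^bsub>Q\<^esub> v) w = cocycle u w \<otimes>\<^bsub>sign_group\<^esub> cocycle v w"
    and "cocycle u (v \<otimes>\<^bsub>Q\<^esub> w) = cocycle u v \<otimes>\<^bsub>sign_group\<^esub> cocycle u w"
    by (simp_all add: power_int_add)
qed

lemma two_torsion_ext_simps [simp]:
  "carrier (two_torsion_ext L J) = carrier Q \<times> {1, -1}"
  "(v, \<epsilon>) \<otimes>\<^bsub>two_torsion_ext L J\<^esub> (w, \<delta>) = (v \<otimes>\<^bsub>tensor L U1\<^esub> w, \<epsilon> * \<delta> * cocycle v w)"
  "\<one>\<^bsub>two_torsion_ext L J\<^esub> = (\<one>\<^bsub>tensor L U1\<^esub>, 1)"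
  by (simp_all add: two_torsion_ext_eq sign_extension_def)

lemma pure_in_two_torsion [simp]: "m \<in> carrier L \<Longrightarrow> pure_tensor L U1 m (-1) \<in> carrier Q"
  unfolding two_torsion_carrier by blast

text \<open>The point \<open>n/2\<close> of the Lie algebra exponentiates to \<open>n \<otimes> (-1)\<close>.\<close>

definition proj_obj where
  "proj_obj s = (pure_tensor L U1 (fst (label s)) (-1), snd (label s))"

lemma proj_obj_fixed_object [simp]:
  "n \<in> carrier L \<Longrightarrow> proj_obj (fixed_object n \<epsilon>) = (pure_tensor L U1 n (-1), \<epsilon>)"
  by (simp add: proj_obj_def)

text \<open>An arrow of a discrete category is its object, so an arrow is sent to the image of its
  source; \<open>proj_obj_Tgt\<close> shows that the target gives the same value.\<close>

definition "proj = \<lparr>Fobj = proj_obj, Farr = proj_obj \<circ> fst\<rparr>"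
definition "loops = \<lparr>Fobj = (\<lambda>_. Tunit FP), Farr = fixed_arrow \<one>\<^bsub>L\<^esub>\<rparr>"

lemma proj_obj_image: "proj_obj ` EO = carrier (two_torsion_ext L J)"
proof (intro equalityI subsetI)
  fix q assume "q \<in> proj_obj ` EO"
  then obtain s where s: "q = proj_obj s" "s \<in> EO" by (rule imageE)
  from s(2) show "q \<in> carrier (two_torsion_ext L J)"
    by (rule EO_eq_fixed_object) (simp add: s(1))
next
  fix q assume "q \<in> carrier (two_torsion_ext L J)"
  then obtain m \<epsilon> where m: "m \<in> carrier L" "\<epsilon> \<in> {1, -1}" "q = (pure_tensor L U1 m (-1), \<epsilon>)"
    unfolding two_torsion_ext_simps two_torsion_carrier by blast
  then show "q \<in> proj_obj ` EO"
    by (intro image_eqI[OF _ fixed_object_EO[OF m(1,2)]]) simp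
qed

lemma proj_obj_Tobj:
  assumes "s \<in> EO" "t \<in> EO"
  shows "proj_obj (Tobj FP s t) = proj_obj s \<otimes>\<^bsub>two_torsion_ext L J\<^esub> proj_obj t"
  using assms
  by - (erule EO_eq_fixed_object[of s], erule EO_eq_fixed_object[of t],
    simp add: Tobj_fixed_object LU.pure_tensor_mult(1) del: fixed_points_simps(7))

text \<open>An arrow moves n by 2m and keeps the sign, and 2m \<otimes> (-1) is trivial.\<close>

lemma proj_obj_Tgt: "f \<in> EA \<Longrightarrow> proj_obj (Tgt FP f) = proj_obj (Src FP f)"
proof -
  assume "f \<in> EA"
  then obtain n \<epsilon> m z where f: "n \<in> carrier L" "m \<in> carrier L"
    "f = (fixed_object n \<epsilon>, (half (incl n), m, z), fixed_object (n \<otimes>\<^bsub>L\<^esub> (m \<otimes>\<^bsub>L\<^esub> m)) \<epsilon>)"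
    unfolding EA_iff by blast
  moreover have "pure_tensor L U1 (m \<otimes>\<^bsub>L\<^esub> m) (-1) = \<one>\<^bsub>tensor L U1\<^esub>"
    using f(2) pure_minus_one_eq_one_iff[of "m \<otimes>\<^bsub>L\<^esub> m"] by auto
  ultimately show ?thesis
    using LU.pure_tensor_mult(1)[of n "m \<otimes>\<^bsub>L\<^esub> m" "-1"] by simp
qed

lemma strict_monoidal_functor_proj:
  "strict_monoidal_functor FP (discrete (two_torsion_ext L J)) proj"
proof -
  have "proj_obj s \<in> carrier (two_torsion_ext L J)" if "s \<in> EO" for s
    using that proj_obj_image by blast
  moreover have "proj_obj (Tunit FP) = \<one>\<^bsub>two_torsion_ext L J\<^esub>"
    by (simp add: Tunit_fixed_object LU.pure_tensor_group(1) del: fixed_points_simps(9))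
  moreover have "fst (Ident FP s) = s" for s by (cases s) simp
  moreover have "fst f = Src FP f" "fst (Comp FP f g) = Src FP g" "fst (Tarr FP f g) = Tobj FP (Src FP f) (Src FP g)" for f g
    by (cases f; cases g; simp)+
  moreover have "Src FP f \<in> EO" if "f \<in> EA" for f
    using that FP.src.hom_closed by simp
  moreover have "proj_obj (Src FP g) = proj_obj (Src FP f)" if "g \<in> EA" "Tgt FP g = Src FP f" for f g
    using proj_obj_Tgt[OF that(1)] that(2) by simp
  ultimately show ?thesis
    by (simp add: strict_monoidal_functor_def is_functor_def proj_def discrete_def proj_obj_Tobj proj_obj_Tgt
        del: fixed_points_simps(5-9))
qed

lemma strict_monoidal_functor_loops: "strict_monoidal_functor (delooping U1) FP loops"
proof -
  have unit: "Tunit FP \<in> EO" by (rule EO_unit[folded fixed_points_simps(9)])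
  have "fixed_arrow \<one>\<^bsub>L\<^esub> 1 = Ident FP (Tunit FP)"
    by (simp add: Tunit_fixed_object fixed_arrow_def del: fixed_points_simps(9)) (simp add: fixed_object_def)
  moreover have "Src FP (fixed_arrow \<one>\<^bsub>L\<^esub> z) = Tunit FP" "Tgt FP (fixed_arrow \<one>\<^bsub>L\<^esub> z) = Tunit FP" for z
    by (simp_all add: Tunit_fixed_object fixed_arrow_def del: fixed_points_simps(9))
  \<comment> \<open>\<open>Comp\<close> multiplies the labels in the opposite order, so
    commutativity of U(1) is used.\<close>
  moreover have "fixed_arrow \<one>\<^bsub>L\<^esub> (z * w) = Comp FP (fixed_arrow \<one>\<^bsub>L\<^esub> z) (fixed_arrow \<one>\<^bsub>L\<^esub> w)" for z w
    by (simp add: fixed_arrow_def mult.commute)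
  moreover have "fixed_arrow \<one>\<^bsub>L\<^esub> (z * w) = Tarr FP (fixed_arrow \<one>\<^bsub>L\<^esub> z) (fixed_arrow \<one>\<^bsub>L\<^esub> w)" for z w
    by (simp add: Tarr_fixed_arrow)
  moreover have "Tobj FP (Tunit FP) (Tunit FP) = Tunit FP"
    using FP.O.l_one[of "Tunit FP"] unit by simp
  ultimately show ?thesis
    using unit by (simp add: strict_monoidal_functor_def is_functor_def loops_def delooping_def fixed_arrow_EA
        del: fixed_points_simps(3-9))
qed

text \<open>The arrow (m, z) out of the unit ends at (2m, 1), so it is a loop only for 2m = 0, that
  is m = 0; the label z is then arbitrary.\<close>

lemma loops_bij:
  "bij_betw (fixed_arrow \<one>\<^bsub>L\<^esub>) (carrier U1) {f \<in> Arr FP. Src FP f = Tunit FP \<and> Tgt FP f = Tunit FP}"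
  unfolding bij_betw_def
proof (intro conjI equalityI subsetI)
  show "inj_on (fixed_arrow \<one>\<^bsub>L\<^esub>) (carrier U1)"
    by (rule inj_onI) (simp add: fixed_arrow_def)
next
  fix f assume "f \<in> fixed_arrow \<one>\<^bsub>L\<^esub> ` carrier U1"
  then obtain z where z: "f = fixed_arrow \<one>\<^bsub>L\<^esub> z" "z \<in> carrier U1" by (rule imageE)
  then have "f \<in> EA" using fixed_arrow_EA[of "\<one>\<^bsub>L\<^esub>" z] by simp
  then show "f \<in> {f \<in> Arr FP. Src FP f = Tunit FP \<and> Tgt FP f = Tunit FP}"
    by (simp add: z fixed_arrow_def Tunit_fixed_object del: fixed_points_simps(9))
next
  fix f assume "f \<in> {f \<in> Arr FP. Src FP f = Tunit FP \<and> Tgt FP f = Tunit FP}"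
  then have f: "f \<in> EA" "Src FP f = fixed_object \<one>\<^bsub>L\<^esub> 1" "Tgt FP f = fixed_object \<one>\<^bsub>L\<^esub> 1"
    by (simp_all only: mem_Collect_eq fixed_points_simps(2) Tunit_fixed_object)
  obtain n \<epsilon> m z where m: "n \<in> carrier L" "m \<in> carrier L" "cmod z = 1"
    "f = (fixed_object n \<epsilon>, (half (incl n), m, z), fixed_object (n \<otimes>\<^bsub>L\<^esub> (m \<otimes>\<^bsub>L\<^esub> m)) \<epsilon>)"
    using f(1) unfolding EA_iff by blast
  have n: "n = \<one>\<^bsub>L\<^esub>" "\<epsilon> = 1"
    using f(2) m by (simp_all add: fixed_object_inject)
  then have "m \<otimes>\<^bsub>L\<^esub> m = \<one>\<^bsub>L\<^esub>"
    using f(3) m by (simp add: fixed_object_inject)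
  then have "m = \<one>\<^bsub>L\<^esub>" by (rule torsion_free[OF m(2)])
  then have "f = fixed_arrow \<one>\<^bsub>L\<^esub> z"
    using m n by (simp add: fixed_arrow_def)
  then show "f \<in> fixed_arrow \<one>\<^bsub>L\<^esub> ` carrier U1"
    by (rule image_eqI) (simp add: m(3))
qed

text \<open>An object in the kernel has sign 1 and n = 2k, and \<open>fixed_arrow k 1\<close> joins
  the unit to it. Centrality holds because loops and identity arrows have trivial lattice part, so
  neither order of multiplication produces a correction factor.\<close>

lemma central_extension:
  "categorical_central_extension U1 FP (two_torsion_ext L J) loops proj"
proof -
  have kernel: "\<exists>f. is_isoarrow FP f \<and> Src FP f = Tunit FP \<and> Tgt FP f = s"
    if s: "s \<in> EO" "proj_obj s = \<one>\<^bsub>two_torsion_ext L J\<^esub>" for s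
  proof -
    obtain n \<epsilon> where n: "n \<in> carrier L" "s = fixed_object n \<epsilon>" using s(1) by (rule EO_eq_fixed_object)
    then have "pure_tensor L U1 n (-1) = \<one>\<^bsub>tensor L U1\<^esub>" "\<epsilon> = 1" using s(2) by simp_all
    with n obtain k where k: "k \<in> carrier L" "s = fixed_object (k \<otimes>\<^bsub>L\<^esub> k) 1"
      by (auto simp: pure_minus_one_eq_one_iff)
    have "fixed_arrow k 1 \<in> EA" by (rule fixed_arrow_EA[OF k(1)]) simp
    then show ?thesis
      by (intro exI[of _ "fixed_arrow k 1"])
        (simp add: k fixed_arrow_def Tunit_fixed_object del: fixed_points_simps(9))
  qed
  have central: "Tarr FP (Ident FP s) (fixed_arrow \<one>\<^bsub>L\<^esub> z) = Tarr FP (fixed_arrow \<one>\<^bsub>L\<^esub> z) (Ident FP s)"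
    if s: "s \<in> EO" for s z
  proof -
    obtain n \<epsilon> where n: "n \<in> carrier L" "s = fixed_object n \<epsilon>" using s by (rule EO_eq_fixed_object)
    have "Ident FP s = (fixed_object n \<epsilon>, (half (incl n), \<one>\<^bsub>L\<^esub>, 1), fixed_object n \<epsilon>)"
      by (simp add: n fixed_object_def)
    then show ?thesis
      using n by (simp add: fixed_arrow_def Tobj_fixed_object del: fixed_points_simps(5,7))
  qed
  show ?thesis
    unfolding categorical_central_extension_def
    using comm_group_U1 strict_categorical_group_fixed_points group_two_torsion_ext
      strict_monoidal_functor_loops strict_monoidal_functor_proj proj_obj_image loops_bij kernel central
    by (simp add: proj_def loops_def)
qed

end

theorem theorem6p3:
  fixes L :: "('l, 'x) monoid_scheme" and J :: "'l \<Rightarrow> 'l \<Rightarrow> int"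
  assumes "free_of_finite_rank L"
    and "biadditive L L additive_group J"
  shows "strict_categorical_group (categorical_torus L J) \<and>
    strict_monoidal_action sign_group (categorical_torus L J) (torus_inversion L) \<and>
    strict_categorical_group (torus_fixed_points L J) \<and>
    crossed_module_isomorphic (crossed_module_of (torus_fixed_points L J)) (Sigma_xmod L J) \<and>
    (\<exists>i p. categorical_central_extension U1 (torus_fixed_points L J) (two_torsion_ext L J) i p)"
proof -
  interpret free_lattice_form L J
    using assms by (simp add: free_lattice_form_def lattice_form_def lattice_form_axioms_def
        free_lattice_form_axioms_def free_of_finite_rank_def)
  show ?thesis
    unfolding torus_fixed_points_def
    by (intro conjI strict_categorical_group_torus strict_monoidal_action_torus
        strict_categorical_group_fixed_points crossed_module_fixed_points)
      (rule exI, rule exI, rule central_extension)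
qed

end
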